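(* Let Assumptions 1 and 2 (stated in the context) hold and let $\alpha>0$. Let $(x_*,u_* )$ be a local optimum of the steady-state problem (P) with $h(x_* )>0$, and let $\mathcal{N}$ be a neighborhood of $(x_*,u_* )$ in which $(x_*,u_* )$ is the only critical point of (P). Assume that $u\mapsto\Phi(w(u))$ has compact level sets. Assume that the quadratic program (SGF) is feasible everywhere in $\mathcal{N}$, that MFCQ or CRCQ holds in $\mathcal{N}$ for (P) and for (SGF), and that unique solutions of (SGF-CL) exist for any initial condition in $\mathcal{N}$ (these conditions on (SGF) and (SGF-CL) being understood for the parameter values $\epsilon,\alpha,\gamma$ in use). Then there exist $\epsilon_*,\gamma_*>0$ such that, for any $\epsilon\in(0,\epsilon_* )$ and $\gamma\ge\gamma_*$, the point $(x_*,u_* )$ is locally asymptotically stable relative to $\mathcal{S}_r$ for the closed loop (SGF-CL).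
   Context: Conventions: for differentiable $g:\mathbb{R}^n\to\mathbb{R}^k$, $\frac{\partial g}{\partial x}\in\mathbb{R}^{k\times n}$ (so partial derivatives of scalar functions are row vectors); for scalar $g$, $\nabla g=(\frac{\partial g}{\partial x})^\top$. Plant: $\dot\xi=f(\xi,\upsilon)$ with $f:\mathbb{R}^n\times\mathbb{R}^m\to\mathbb{R}^n$. Assumption 1: for every constant input $\upsilon\equiv u$ the system has a unique globally exponentially stable equilibrium; it is denoted $w(u)$, giving a map $w:\mathbb{R}^m\to\mathbb{R}^n$ with $f(w(u),u)=0$. Known consequence of Assumption 1, as recalled by the paper from the literature: there exist a function $W:\mathbb{R}^n\times\mathbb{R}^m\to\mathbb{R}$ and constants $d_1,d_2,d_3,d_4>0$ such that for all $(x,u)$: $d_1\|x-w(u)\|^2\le W(x,u)\le d_2\|x-w(u)\|^2$, $\frac{\partial W}{\partial x}(x,u)f(x,u)\le-d_3\|x-w(u)\|^2$, $\|\frac{\partial W}{\partial u}(x,u)\|\le d_4\|x-w(u)\|$. Data: $\Phi,h:\mathbb{R}^n\to\mathbb{R}$, $b:\mathbb{R}^m\to\mathbb{R}$. Fix $\beta>0$ and set $h_0(x,u)=h(x)$, $h_i(x,u)=\frac{\partial h_{i-1}}{\partial x}(x,u)f(x,u)+\beta h_{i-1}(x,u)$ for $i\ge1$. Let $\mathcal{S}=\{(x,u): h(x)\ge0,\ b(u)\ge0\}$ and $\mathcal{S}_i=\{(x,u): b(u)\ge0,\ h_i(x,u)\ge0\}$ for $i\ge0$, so $\mathcal{S}_0=\mathcal{S}$.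 Assumption 2: (1) there is an integer $r\ge1$ such that $f$ is $(r+1)$-times and $h$ is $(r+2)$-times continuously differentiable; $\mathcal{S}_r\ne\emptyset$; $\frac{\partial h_r}{\partial u}(x,u)\ne0$ for all $(x,u)\in\mathcal{S}_r$ with $h_r(x,u)=0$; and $\frac{\partial h_i}{\partial u}(x,u)=0$ for all $(x,u)\in\mathcal{S}_r$ and all $i<r$. (2) $b$ is twice continuously differentiable, and $b(u)=0$ implies $\nabla b(u)\neq0$ for all $(x,u)\in\mathcal{S}$. (3) $\Phi$ and $w$ are twice continuously differentiable. This fixes $r$. Steady-state problem (P): $\min_{x,u}\Phi(x)$ s.t. $x=w(u)$, $h(x)\ge0$, $b(u)\ge0$. A local optimum is a feasible point $(x_*,u_* )$ with $\Phi(x_* )\le\Phi(x)$ for all feasible $(x,u)$ in some neighborhood of it. A critical (KKT) point of (P) is $(x,u)$ for which there exist $\lambda_h,\lambda_b\ge0$, $\mu\in\mathbb{R}^n$ with $\nabla\Phi(x)-\lambda_h\nabla h(x)+\mu=0$, $-\lambda_b\nabla b(u)-\frac{\partial w}{\partial u}(u)^\top\mu=0$, $\lambda_hh(x)=0$, $\lambda_bb(u)=0$, $h(x)\ge0$, $b(u)\ge0$, $x=w(u)$. Quadratic program (SGF), with parameters $\epsilon,\alpha,\gamma>0$: for given $(x,u)$, minimize over $q\in\mathbb{R}^m$ the function $\frac12\|q+\epsilon\frac{\partial w}{\partial u}(u)^\top\nabla\Phi(x)\|^2$ subject to (c1) $\nabla b(u)^\top q+\alpha b(u)\ge0$ and (c2)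 $\frac{\partial h_r}{\partial x}(x,u)f(x,u)+\frac{\partial h_r}{\partial u}(x,u)q+\gamma h_r(x,u)\ge0$. When feasible, its unique minimizer is $g_{\epsilon,\alpha,\gamma}(x,u)$. Closed loop (SGF-CL): $\dot\xi=f(\xi,\upsilon)$, $\dot\upsilon=g_{\epsilon,\alpha,\gamma}(\xi,\upsilon)$. Constraint qualifications ("holds in $\mathcal{N}$" means at each point of $\mathcal{N}$). For (P) at $(x,u)$: MFCQ means there exist $\psi_x\in\mathbb{R}^n,\psi_u\in\mathbb{R}^m$ with $\psi_x=\frac{\partial w}{\partial u}(u)\psi_u$, $\nabla h(x)^\top\psi_x>0$ if $h(x)=0$, and $\nabla b(u)^\top\psi_u>0$ if $b(u)=0$; CRCQ means that for every subset of the inequality constraints active at $(x,u)$, the gradients (with respect to $(x,u)$) of these constraints together with the gradients of the $n$ components of $x-w(u)$ have constant rank in a neighborhood of $(x,u)$. For (SGF) at $(x,u)$, with active constraints among (c1), (c2) taken at $q=g_{\epsilon,\alpha,\gamma}(x,u)$: MFCQ means there is $\psi\in\mathbb{R}^m$ with $\nabla b(u)^\top\psi>0$ if (c1) is active and $\frac{\partial h_r}{\partial u}(x,u)\psi>0$ if (c2) is active; CRCQ means that for every subset of the active constraints, the corresponding gradients $\nabla b(u')$ (for (c1)) and $\frac{\partial h_r}{\partial u}(x',u')^\top$ (for (c2)) have constant rank for $(x',u')$ in a neighborhood of $(x,u)$. Local asymptotic stability of $(x_*,u_* )$ relative to $\mathcal{S}_r$: there exist neighborhoods $\mathcal{N}_1,\mathcal{N}_2$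 of $(x_*,u_* )$ such that trajectories with initial condition in $\mathcal{N}_1\cap\mathcal{S}_r$ stay in $\mathcal{N}_2\cap\mathcal{S}_r$ for all $t\ge0$ and converge to $(x_*,u_* )$ as $t\to\infty$. *)

theory Defs
  imports "HOL-Analysis.Analysis"
begin

(* cont_diff k g: g is k times continuously differentiable on the whole space.  The derivative is
   iterated along fixed directions; on a finite-dimensional domain this is the usual class C^k. *)
primrec cont_diff :: "nat \<Rightarrow> ('a::real_normed_vector \<Rightarrow> 'b::real_normed_vector) \<Rightarrow> bool" where
  "cont_diff 0 g \<longleftrightarrow> continuous_on UNIV g"
| "cont_diff (Suc k) g \<longleftrightarrow>
     (\<forall>x. g differentiable (at x)) \<and> (\<forall>v. cont_diff k (\<lambda>x. frechet_derivative g (at x) v))"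

(* For a scalar g the row vector dg/dx applied to v is written as the inner product
   gradient g x \<bullet> v; for vector-valued functions the library's jacobian is used.  The domain
   is an arbitrary Euclidean space so that gradients with respect to x, u and (x,u) are covered. *)
definition gradient :: "('a::euclidean_space \<Rightarrow> real) \<Rightarrow> 'a \<Rightarrow> 'a" where
  "gradient g x = (\<Sum>e\<in>Basis. frechet_derivative g (at x) e *\<^sub>R e)"

definition grad_x :: "('a::euclidean_space \<times> 'b \<Rightarrow> real) \<Rightarrow> 'a \<times> 'b \<Rightarrow> 'a" where
  "grad_x g = (\<lambda>(x, u). gradient (\<lambda>x'. g (x', u)) x)"

definition grad_u :: "('a \<times> 'b::euclidean_space \<Rightarrow> real) \<Rightarrow> 'a \<times> 'b \<Rightarrow> 'b" where
  "grad_u g = (\<lambda>(x, u). gradient (\<lambda>u'. g (x, u')) u)"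

(* Solutions of z' = F z on the time interval I, where F is meaningful only on D. *)
definition solves ::
    "('a::real_normed_vector \<Rightarrow> 'a) \<Rightarrow> 'a set \<Rightarrow> real set \<Rightarrow> (real \<Rightarrow> 'a) \<Rightarrow> bool" where
  "solves F D I z \<longleftrightarrow>
     (\<forall>t\<in>I. z t \<in> D \<and> (z has_vector_derivative F (z t)) (at t within I))"

definition locally_uniquely_solvable ::
    "('a::real_normed_vector \<Rightarrow> 'a) \<Rightarrow> 'a set \<Rightarrow> 'a \<Rightarrow> bool" where
  "locally_uniquely_solvable F D z0 \<longleftrightarrow>
     (\<exists>T>0. \<exists>z. solves F D {0..<T} z \<and> z 0 = z0 \<and>
        (\<forall>y. solves F D {0..<T} y \<and> y 0 = z0 \<longrightarrow> (\<forall>t\<in>{0..<T}. y t = z t)))"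

(* Trajectories are the solutions on [0,\<infinity>); their existence is part of the property.  N2 is
   existentially quantified along with N1, so this is weaker than the usual epsilon-delta notion. *)
definition loc_asymp_stable_rel ::
    "('a::real_normed_vector \<Rightarrow> 'a) \<Rightarrow> 'a set \<Rightarrow> 'a set \<Rightarrow> 'a \<Rightarrow> bool" where
  "loc_asymp_stable_rel F D S zs \<longleftrightarrow>
     (\<exists>N1 N2. zs \<in> interior N1 \<and> zs \<in> interior N2 \<and>
        (\<forall>z0\<in>N1 \<inter> S.
           (\<exists>z. solves F D {0..} z \<and> z 0 = z0) \<and>
           (\<forall>z. solves F D {0..} z \<and> z 0 = z0 \<longrightarrow>
              (\<forall>t\<ge>0. z t \<in> N2 \<inter> S) \<and> (z \<longlongrightarrow> zs) at_top)))"

definition glob_exp_stable_eq ::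
    "((real^'n) \<times> (real^'m) \<Rightarrow> real^'n) \<Rightarrow> real^'m \<Rightarrow> real^'n \<Rightarrow> bool" where
  "glob_exp_stable_eq f u xe \<longleftrightarrow>
     f (xe, u) = 0 \<and>
     (\<forall>x0. \<exists>\<xi>. solves (\<lambda>x. f (x, u)) UNIV {0..} \<xi> \<and> \<xi> 0 = x0) \<and>
     (\<exists>k>0. \<exists>c>0. \<forall>\<xi>. solves (\<lambda>x. f (x, u)) UNIV {0..} \<xi> \<longrightarrow>
        (\<forall>t\<ge>0. norm (\<xi> t - xe) \<le> k * norm (\<xi> 0 - xe) * exp (- c * t)))"

(* The constants k, c in glob_exp_stable_eq may depend on u. *)
definition steady_state_map ::
    "((real^'n) \<times> (real^'m) \<Rightarrow> real^'n) \<Rightarrow> (real^'m \<Rightarrow> real^'n) \<Rightarrow> bool" where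
  "steady_state_map f w \<longleftrightarrow>
     (\<forall>u. glob_exp_stable_eq f u (w u) \<and> (\<forall>x. glob_exp_stable_eq f u x \<longrightarrow> x = w u))"

primrec h_seq ::
    "((real^'n) \<times> (real^'m) \<Rightarrow> real^'n) \<Rightarrow> (real^'n \<Rightarrow> real) \<Rightarrow> real \<Rightarrow> nat \<Rightarrow>
     (real^'n) \<times> (real^'m) \<Rightarrow> real" where
  "h_seq f h \<beta> 0 = (\<lambda>(x, u). h x)"
| "h_seq f h \<beta> (Suc i) = (\<lambda>(x, u).
     grad_x (h_seq f h \<beta> i) (x, u) \<bullet> f (x, u) + \<beta> * h_seq f h \<beta> i (x, u))"

definition safe_set ::
    "((real^'n) \<times> (real^'m) \<Rightarrow> real^'n) \<Rightarrow> (real^'n \<Rightarrow> real) \<Rightarrow> (real^'m \<Rightarrow> real) \<Rightarrow> real \<Rightarrow> nat \<Rightarrow>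
     ((real^'n) \<times> (real^'m)) set" where
  "safe_set f h b \<beta> i = {(x, u). b u \<ge> 0 \<and> h_seq f h \<beta> i (x, u) \<ge> 0}"

(* The h_seq f h \<beta> i are differentiated only for i \<le> r; there they are of class C^2 or better. *)
definition regular_data ::
    "((real^'n) \<times> (real^'m) \<Rightarrow> real^'n) \<Rightarrow> (real^'m \<Rightarrow> real^'n) \<Rightarrow> (real^'n \<Rightarrow> real) \<Rightarrow>
     (real^'n \<Rightarrow> real) \<Rightarrow> (real^'m \<Rightarrow> real) \<Rightarrow> real \<Rightarrow> nat \<Rightarrow> bool" where
  "regular_data f w \<Phi> h b \<beta> r \<longleftrightarrow>
     r \<ge> 1 \<and> cont_diff (r + 1) f \<and> cont_diff (r + 2) h \<and>
     safe_set f h b \<beta> r \<noteq> {} \<and>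
     (\<forall>z\<in>safe_set f h b \<beta> r. h_seq f h \<beta> r z = 0 \<longrightarrow> grad_u (h_seq f h \<beta> r) z \<noteq> 0) \<and>
     (\<forall>z\<in>safe_set f h b \<beta> r. \<forall>i<r. grad_u (h_seq f h \<beta> i) z = 0) \<and>
     cont_diff 2 b \<and>
     (\<forall>x u. h x \<ge> 0 \<and> b u \<ge> 0 \<longrightarrow> b u = 0 \<longrightarrow> gradient b u \<noteq> 0) \<and>
     cont_diff 2 \<Phi> \<and> cont_diff 2 w"

definition P_feasible ::
    "(real^'m \<Rightarrow> real^'n) \<Rightarrow> (real^'n \<Rightarrow> real) \<Rightarrow> (real^'m \<Rightarrow> real) \<Rightarrow> ((real^'n) \<times> (real^'m)) set" where
  "P_feasible w h b = {(x, u). x = w u \<and> h x \<ge> 0 \<and> b u \<ge> 0}"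

definition P_local_optimum ::
    "(real^'m \<Rightarrow> real^'n) \<Rightarrow> (real^'n \<Rightarrow> real) \<Rightarrow> (real^'n \<Rightarrow> real) \<Rightarrow> (real^'m \<Rightarrow> real) \<Rightarrow>
     (real^'n) \<times> (real^'m) \<Rightarrow> bool" where
  "P_local_optimum w \<Phi> h b zs \<longleftrightarrow>
     zs \<in> P_feasible w h b \<and>
     (\<exists>N. zs \<in> interior N \<and> (\<forall>z\<in>N \<inter> P_feasible w h b. \<Phi> (fst zs) \<le> \<Phi> (fst z)))"

definition P_critical ::
    "(real^'m \<Rightarrow> real^'n) \<Rightarrow> (real^'n \<Rightarrow> real) \<Rightarrow> (real^'n \<Rightarrow> real) \<Rightarrow> (real^'m \<Rightarrow> real) \<Rightarrow>
     (real^'n) \<times> (real^'m) \<Rightarrow> bool" where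
  "P_critical w \<Phi> h b = (\<lambda>(x, u).
     \<exists>lh lb \<mu>. lh \<ge> 0 \<and> lb \<ge> 0 \<and>
       gradient \<Phi> x - lh *\<^sub>R gradient h x + \<mu> = 0 \<and>
       - lb *\<^sub>R gradient b u - transpose (jacobian w (at u)) *v \<mu> = 0 \<and>
       lh * h x = 0 \<and> lb * b u = 0 \<and> h x \<ge> 0 \<and> b u \<ge> 0 \<and> x = w u)"

definition SGF_cost ::
    "(real^'m \<Rightarrow> real^'n) \<Rightarrow> (real^'n \<Rightarrow> real) \<Rightarrow> real \<Rightarrow> (real^'n) \<times> (real^'m) \<Rightarrow> real^'m \<Rightarrow> real" where
  "SGF_cost w \<Phi> \<epsilon> = (\<lambda>(x, u) q.
     1/2 * (norm (q + \<epsilon> *\<^sub>R (transpose (jacobian w (at u)) *v gradient \<Phi> x)))\<^sup>2)"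

(* SGF_c1 and SGF_c2 are the left-hand sides of the two constraints "... \<ge> 0". *)
definition SGF_c1 ::
    "(real^'m \<Rightarrow> real) \<Rightarrow> real \<Rightarrow> (real^'n) \<times> (real^'m) \<Rightarrow> real^'m \<Rightarrow> real" where
  "SGF_c1 b \<alpha> = (\<lambda>(x, u) q. gradient b u \<bullet> q + \<alpha> * b u)"

definition SGF_c2 ::
    "((real^'n) \<times> (real^'m) \<Rightarrow> real^'n) \<Rightarrow> (real^'n \<Rightarrow> real) \<Rightarrow> real \<Rightarrow> nat \<Rightarrow> real \<Rightarrow>
     (real^'n) \<times> (real^'m) \<Rightarrow> real^'m \<Rightarrow> real" where
  "SGF_c2 f h \<beta> r \<gamma> z q =
     grad_x (h_seq f h \<beta> r) z \<bullet> f z + grad_u (h_seq f h \<beta> r) z \<bullet> q + \<gamma> * h_seq f h \<beta> r z"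

definition SGF_feasible ::
    "((real^'n) \<times> (real^'m) \<Rightarrow> real^'n) \<Rightarrow> (real^'n \<Rightarrow> real) \<Rightarrow> (real^'m \<Rightarrow> real) \<Rightarrow> real \<Rightarrow> nat \<Rightarrow>
     real \<Rightarrow> real \<Rightarrow> (real^'n) \<times> (real^'m) \<Rightarrow> (real^'m) set" where
  "SGF_feasible f h b \<beta> r \<alpha> \<gamma> z = {q. SGF_c1 b \<alpha> z q \<ge> 0 \<and> SGF_c2 f h \<beta> r \<gamma> z q \<ge> 0}"

(* Meaningful only at points where the quadratic program is feasible; the minimizer is then unique. *)
definition SGF_control ::
    "((real^'n) \<times> (real^'m) \<Rightarrow> real^'n) \<Rightarrow> (real^'m \<Rightarrow> real^'n) \<Rightarrow> (real^'n \<Rightarrow> real) \<Rightarrow>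
     (real^'n \<Rightarrow> real) \<Rightarrow> (real^'m \<Rightarrow> real) \<Rightarrow> real \<Rightarrow> nat \<Rightarrow> real \<Rightarrow> real \<Rightarrow> real \<Rightarrow>
     (real^'n) \<times> (real^'m) \<Rightarrow> real^'m" where
  "SGF_control f w \<Phi> h b \<beta> r \<epsilon> \<alpha> \<gamma> z =
     arg_min (SGF_cost w \<Phi> \<epsilon> z) (\<lambda>q. q \<in> SGF_feasible f h b \<beta> r \<alpha> \<gamma> z)"

definition SGF_domain ::
    "((real^'n) \<times> (real^'m) \<Rightarrow> real^'n) \<Rightarrow> (real^'n \<Rightarrow> real) \<Rightarrow> (real^'m \<Rightarrow> real) \<Rightarrow> real \<Rightarrow> nat \<Rightarrow>
     real \<Rightarrow> real \<Rightarrow> ((real^'n) \<times> (real^'m)) set" where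
  "SGF_domain f h b \<beta> r \<alpha> \<gamma> = {z. SGF_feasible f h b \<beta> r \<alpha> \<gamma> z \<noteq> {}}"

definition SGF_closed_loop ::
    "((real^'n) \<times> (real^'m) \<Rightarrow> real^'n) \<Rightarrow> (real^'m \<Rightarrow> real^'n) \<Rightarrow> (real^'n \<Rightarrow> real) \<Rightarrow>
     (real^'n \<Rightarrow> real) \<Rightarrow> (real^'m \<Rightarrow> real) \<Rightarrow> real \<Rightarrow> nat \<Rightarrow> real \<Rightarrow> real \<Rightarrow> real \<Rightarrow>
     (real^'n) \<times> (real^'m) \<Rightarrow> (real^'n) \<times> (real^'m)" where
  "SGF_closed_loop f w \<Phi> h b \<beta> r \<epsilon> \<alpha> \<gamma> z = (f z, SGF_control f w \<Phi> h b \<beta> r \<epsilon> \<alpha> \<gamma> z)"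

(* The family V of vector fields has constant rank near z. *)
definition constant_rank :: "('a::topological_space \<Rightarrow> 'b::euclidean_space) set \<Rightarrow> 'a \<Rightarrow> bool" where
  "constant_rank V z \<longleftrightarrow>
     (\<forall>\<^sub>F z' in nhds z. dim ((\<lambda>v. v z') ` V) = dim ((\<lambda>v. v z) ` V))"

definition P_MFCQ ::
    "(real^'m \<Rightarrow> real^'n) \<Rightarrow> (real^'n \<Rightarrow> real) \<Rightarrow> (real^'m \<Rightarrow> real) \<Rightarrow>
     (real^'n) \<times> (real^'m) \<Rightarrow> bool" where
  "P_MFCQ w h b = (\<lambda>(x, u).
     \<exists>psi_x psi_u. psi_x = jacobian w (at u) *v psi_u \<and>
       (h x = 0 \<longrightarrow> gradient h x \<bullet> psi_x > 0) \<and> (b u = 0 \<longrightarrow> gradient b u \<bullet> psi_u > 0))"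

definition P_CRCQ ::
    "(real^'m \<Rightarrow> real^'n) \<Rightarrow> (real^'n \<Rightarrow> real) \<Rightarrow> (real^'m \<Rightarrow> real) \<Rightarrow>
     (real^'n) \<times> (real^'m) \<Rightarrow> bool" where
  "P_CRCQ w h b z \<longleftrightarrow>
     (\<forall>A \<subseteq> {g \<in> {\<lambda>(x, u). h x, \<lambda>(x, u). b u}. g z = 0}.
        constant_rank (gradient ` (A \<union> range (\<lambda>j (x, u). (x - w u) $ j))) z)"

definition SGF_MFCQ ::
    "((real^'n) \<times> (real^'m) \<Rightarrow> real^'n) \<Rightarrow> (real^'m \<Rightarrow> real^'n) \<Rightarrow> (real^'n \<Rightarrow> real) \<Rightarrow>
     (real^'n \<Rightarrow> real) \<Rightarrow> (real^'m \<Rightarrow> real) \<Rightarrow> real \<Rightarrow> nat \<Rightarrow> real \<Rightarrow> real \<Rightarrow> real \<Rightarrow>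
     (real^'n) \<times> (real^'m) \<Rightarrow> bool" where
  "SGF_MFCQ f w \<Phi> h b \<beta> r \<epsilon> \<alpha> \<gamma> z \<longleftrightarrow>
     (let q = SGF_control f w \<Phi> h b \<beta> r \<epsilon> \<alpha> \<gamma> z in
      \<exists>\<psi>. (SGF_c1 b \<alpha> z q = 0 \<longrightarrow> gradient b (snd z) \<bullet> \<psi> > 0) \<and>
          (SGF_c2 f h \<beta> r \<gamma> z q = 0 \<longrightarrow> grad_u (h_seq f h \<beta> r) z \<bullet> \<psi> > 0))"

definition SGF_CRCQ ::
    "((real^'n) \<times> (real^'m) \<Rightarrow> real^'n) \<Rightarrow> (real^'m \<Rightarrow> real^'n) \<Rightarrow> (real^'n \<Rightarrow> real) \<Rightarrow>
     (real^'n \<Rightarrow> real) \<Rightarrow> (real^'m \<Rightarrow> real) \<Rightarrow> real \<Rightarrow> nat \<Rightarrow> real \<Rightarrow> real \<Rightarrow> real \<Rightarrow>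
     (real^'n) \<times> (real^'m) \<Rightarrow> bool" where
  "SGF_CRCQ f w \<Phi> h b \<beta> r \<epsilon> \<alpha> \<gamma> z \<longleftrightarrow>
     (let q = SGF_control f w \<Phi> h b \<beta> r \<epsilon> \<alpha> \<gamma> z in
      \<forall>A \<subseteq> (if SGF_c1 b \<alpha> z q = 0 then {\<lambda>(x, u). gradient b u} else {}) \<union>
            (if SGF_c2 f h \<beta> r \<gamma> z q = 0 then {grad_u (h_seq f h \<beta> r)} else {}).
        constant_rank A z)"

end

theory Submission
  imports Defs
begin

text \<open>
  At an equilibrium \<open>(w u, u)\<close> all \<open>h\<^sub>i\<close> are positive multiples of \<open>h\<close>.  Since \<open>h\<close> is positive at the
  optimum, \<open>h\<^sub>r\<close> is positive near it and the second constraint of the quadratic program is inactive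
  near it (\<open>SGF_c2_inactive\<close>).  The controller is then the projection of
  \<open>- \<epsilon> * reduced gradient\<close> onto the half-space of the first constraint
  (\<open>SGF_control_eq_halfspace_proj\<close>), which has a continuous closed form.  Along it
  \<open>db(u)/dt \<ge> - \<alpha> b(u)\<close>, so that \<open>{b \<ge> 0}\<close> is forward invariant and the safe set is, locally, just
  this set.

  The Lyapunov function is \<open>V(x, u) = \<Phi>(w u) - \<Phi>(w us) + B e e\<close> with \<open>e = x - w u\<close>.  Here \<open>B\<close> is a
  quadratic form that decreases along the linearization of the plant at the optimum
  (\<open>steady_state_lyapunov_form\<close>); it exists because the linearization inherits exponential stability
  from the plant.  One form suffices for all nearby inputs, as the plant is continuously
  differentiable.  The optimality conditions of the program give
  \<open>reduced gradient \<bullet> q \<le> - |q|\<^sup>2 / \<epsilon>\<close>, while replacing \<open>x\<close> by \<open>w u\<close> and moving the equilibrium with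
  the input cost at most \<open>M |e| |q|\<close>, where \<open>M\<close> does not depend on \<open>\<epsilon>\<close>.  For small \<open>\<epsilon>\<close> the two
  negative squares dominate and \<open>dV/dt \<le> - |q|\<^sup>2 - |e|\<^sup>2 / 8\<close>.

  The right-hand side vanishes exactly when \<open>x = w u\<close> and \<open>q = 0\<close>, that is, at critical points, of
  which there is only one nearby.  For the same reason the local minimum is strict on \<open>{b \<ge> 0}\<close>
  (\<open>steady_state_cost_minimal\<close>), so that \<open>V\<close> is positive definite there.  Lyapunov's method relative
  to \<open>{b \<ge> 0}\<close> (\<open>lyapunov_asymptotic_stability_rel\<close>) concludes; global existence follows from local
  existence because solutions remain in a compact set.  The neighborhoods may
  depend on \<open>\<epsilon>\<close> and \<open>\<gamma>\<close>, so that any positive lower bound on \<open>\<gamma>\<close> will do.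
\<close>

section \<open>Calculus of the class \<open>cont_diff\<close>\<close>

lemma cont_diff_continuous:
  "cont_diff k g \<Longrightarrow> continuous_on UNIV g"
  by (cases k)
     (auto simp: differentiable_on_def intro!: differentiable_imp_continuous_on)

lemma cont_diff_Suc_imp: "cont_diff (Suc k) g \<Longrightarrow> cont_diff k g"
proof (induction k arbitrary: g)
  case 0
  then show ?case using cont_diff_continuous[OF 0] by simp
next
  case (Suc k)
  then show ?case by (metis cont_diff.simps(2))
qed

lemma cont_diff_mono: "j \<le> k \<Longrightarrow> cont_diff k g \<Longrightarrow> cont_diff j g"
  by (induction k rule: dec_induct) (auto dest: cont_diff_Suc_imp simp del: cont_diff.simps)

text \<open>The recursion of the definition is on iterated directional derivatives; every closure property
  is an induction on the order that rewrites the directional derivative by the calculus rule.\<close>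

lemma cont_diff_SucI:
  assumes "\<And>x. (g has_derivative g' x) (at x)" and "\<And>v. cont_diff k (\<lambda>x. g' x v)"
  shows "cont_diff (Suc k) g"
  using assms by (auto simp: differentiable_def frechet_derivative_at[OF assms(1), symmetric])

lemma cont_diff_SucD:
  assumes "cont_diff (Suc k) g"
  shows "(g has_derivative frechet_derivative g (at x)) (at x)"
    and "cont_diff k (\<lambda>x. frechet_derivative g (at x) v)"
  using assms by (auto simp: frechet_derivative_works)

lemma cont_diff_const: "cont_diff k (\<lambda>x. c)"
proof (induction k arbitrary: c)
  case (Suc k)
  show ?case by (rule cont_diff_SucI[where g' = "\<lambda>x v. 0"]) (auto intro: Suc)
qed simp

lemma cont_diff_add:
  "cont_diff k g \<Longrightarrow> cont_diff k h \<Longrightarrow> cont_diff k (\<lambda>x. g x + h x)"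
proof (induction k arbitrary: g h)
  case 0
  then show ?case by (auto intro: continuous_intros)
next
  case (Suc k)
  show ?case
    by (rule cont_diff_SucI[OF has_derivative_add[OF cont_diff_SucD(1)[OF Suc.prems(1)]
            cont_diff_SucD(1)[OF Suc.prems(2)]]])
       (intro Suc.IH cont_diff_SucD(2) Suc.prems)
qed

lemma cont_diff_sum:
  "(\<And>i. i \<in> I \<Longrightarrow> cont_diff k (g i)) \<Longrightarrow> cont_diff k (\<lambda>x. \<Sum>i\<in>I. g i x)"
  by (induction I rule: infinite_finite_induct) (auto intro: cont_diff_add cont_diff_const)

lemma cont_diff_mult:
  fixes g h :: "'a::real_normed_vector \<Rightarrow> real"
  shows "cont_diff k g \<Longrightarrow> cont_diff k h \<Longrightarrow> cont_diff k (\<lambda>x. g x * h x)"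
proof (induction k arbitrary: g h)
  case 0
  then show ?case by (auto intro: continuous_intros)
next
  case (Suc k)
  show ?case
    by (rule cont_diff_SucI[OF has_derivative_mult[OF cont_diff_SucD(1)[OF Suc.prems(1)]
            cont_diff_SucD(1)[OF Suc.prems(2)]]])
       (intro Suc.IH cont_diff_add cont_diff_SucD(2) Suc.prems cont_diff_Suc_imp[OF Suc.prems(1)]
          cont_diff_Suc_imp[OF Suc.prems(2)])
qed

lemma cont_diff_inner_right:
  fixes g :: "'a::real_normed_vector \<Rightarrow> 'b::real_inner"
  shows "cont_diff k g \<Longrightarrow> cont_diff k (\<lambda>x. g x \<bullet> e)"
proof (induction k arbitrary: g)
  case 0
  then show ?case by (auto intro: continuous_intros)
next
  case (Suc k)
  show ?case
    by (rule cont_diff_SucI[OF has_derivative_inner_left[OF cont_diff_SucD(1)[OF Suc.prems]]])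
       (intro Suc.IH cont_diff_SucD(2) Suc.prems)
qed

lemma cont_diff_scaleR_const:
  fixes g :: "'a::real_normed_vector \<Rightarrow> real"
  shows "cont_diff k g \<Longrightarrow> cont_diff k (\<lambda>x. g x *\<^sub>R c)"
proof (induction k arbitrary: g)
  case 0
  then show ?case by (auto intro: continuous_intros)
next
  case (Suc k)
  show ?case
    by (rule cont_diff_SucI[OF has_derivative_scaleR_left[OF cont_diff_SucD(1)[OF Suc.prems]]])
       (intro Suc.IH cont_diff_SucD(2) Suc.prems)
qed

lemma cont_diff_gradient: "cont_diff (Suc k) g \<Longrightarrow> cont_diff k (gradient g)"
  unfolding gradient_def[abs_def]
  by (intro cont_diff_sum cont_diff_scaleR_const cont_diff_SucD(2))

lemma cont_diff_fst:
  fixes g :: "'a::real_normed_vector \<Rightarrow> 'c::real_normed_vector"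
  shows "cont_diff k g \<Longrightarrow> cont_diff k (\<lambda>z::'a \<times> 'b::real_normed_vector. g (fst z))"
proof (induction k arbitrary: g)
  case 0
  then show ?case by (auto intro!: continuous_on_compose2[of UNIV g] continuous_intros)
next
  case (Suc k)
  have d: "((\<lambda>z::'a \<times> 'b. g (fst z)) has_derivative (\<lambda>v. frechet_derivative g (at (fst z)) (fst v))) (at z)" for z
    by (rule has_derivative_compose[OF has_derivative_fst[OF has_derivative_ident] cont_diff_SucD(1)[OF Suc.prems]])
  have "cont_diff k (\<lambda>z::'a \<times> 'b. frechet_derivative g (at (fst z)) (fst v))" for v :: "'a \<times> 'b"
    by (rule Suc.IH[OF cont_diff_SucD(2)[OF Suc.prems]])
  with d show ?case by (rule cont_diff_SucI)
qed

lemma gradient_inner: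
  assumes "g differentiable (at x)"
  shows "gradient g x \<bullet> v = frechet_derivative g (at x) v"
proof -
  have "linear (frechet_derivative g (at x))"
    by (rule linear_frechet_derivative[OF assms])
  then have "frechet_derivative g (at x) v = (\<Sum>e\<in>Basis. (v \<bullet> e) *\<^sub>R frechet_derivative g (at x) e)"
    by (subst euclidean_representation[of v, symmetric])
       (simp add: linear_sum linear_scale del: euclidean_representation)
  then show ?thesis
    by (simp add: gradient_def inner_sum_left inner_commute[of v] mult.commute)
qed

lemma grad_x_inner:
  fixes g :: "'a::euclidean_space \<times> 'b::real_normed_vector \<Rightarrow> real"
  assumes "(g has_derivative g') (at (x, u))"
  shows "grad_x g (x, u) \<bullet> v = g' (v, 0)"
proof -
  have "((\<lambda>x'. g (x', u)) has_derivative (\<lambda>v. g' (v, 0))) (at x)"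
    by (rule has_derivative_compose[of "\<lambda>x'. (x', u)" "\<lambda>v. (v, 0)" x UNIV g g'])
       (auto intro!: derivative_eq_intros assms)
  then show ?thesis
    unfolding grad_x_def split
    by (subst gradient_inner) (auto simp: differentiable_def frechet_derivative_at[symmetric])
qed

lemma grad_u_inner:
  fixes g :: "'a::real_normed_vector \<times> 'b::euclidean_space \<Rightarrow> real"
  assumes "(g has_derivative g') (at (x, u))"
  shows "grad_u g (x, u) \<bullet> v = g' (0, v)"
proof -
  have "((\<lambda>u'. g (x, u')) has_derivative (\<lambda>v. g' (0, v))) (at u)"
    by (rule has_derivative_compose[of "\<lambda>u'. (x, u')" "\<lambda>v. (0, v)" u UNIV g g'])
       (auto intro!: derivative_eq_intros assms)
  then show ?thesis
    unfolding grad_u_def split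
    by (subst gradient_inner) (auto simp: differentiable_def frechet_derivative_at[symmetric])
qed

text \<open>Each step of the recursion costs one derivative of \<open>h\<close>; the products with \<open>f\<close> cost at most as
  many of \<open>f\<close>.\<close>

lemma cont_diff_h_seq:
  fixes f :: "(real^'a) \<times> (real^'b) \<Rightarrow> real^'a"
  shows   "cont_diff (k + i) f \<Longrightarrow> cont_diff (k + i) h \<Longrightarrow> cont_diff k (h_seq f h \<beta> i)"
proof (induction i arbitrary: k)
  case 0
  then show ?case using cont_diff_fst[of k h] by (simp add: case_prod_beta)
next
  case (Suc i)
  let ?g = "h_seq f h \<beta> i"
  have g: "cont_diff (Suc k) ?g"
    by (rule Suc.IH) (use Suc.prems in simp_all)
  have f: "cont_diff k f"
    by (rule cont_diff_mono[OF _ Suc.prems(1)]) simp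
  have "h_seq f h \<beta> (Suc i) =
      (\<lambda>z. (\<Sum>e\<in>Basis. (f z \<bullet> e) * frechet_derivative ?g (at z) (e, 0)) + \<beta> * ?g z)" (is "_ = ?R")
  proof
    fix z
    obtain x :: "real^'a" and u :: "real^'b" where z: "z = (x, u)" by force
    have "grad_x ?g (x, u) \<bullet> f (x, u) = (\<Sum>e\<in>Basis. (f z \<bullet> e) * (grad_x ?g (x, u) \<bullet> e))"
      by (subst euclidean_inner) (simp add: z mult.commute)
    then show "h_seq f h \<beta> (Suc i) z = ?R z"
      by (simp add: z grad_x_inner[OF cont_diff_SucD(1)[OF g]])
  qed
  moreover have "cont_diff k ?R"
    by (intro cont_diff_add cont_diff_sum cont_diff_mult cont_diff_inner_right cont_diff_const f
        cont_diff_SucD(2)[OF g] cont_diff_Suc_imp[OF g])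
  ultimately show ?case by simp
qed

section \<open>Local estimates for continuously differentiable maps\<close>

lemma linear_eq_sum_Basis:
  assumes "linear L"
  shows "L v = (\<Sum>e\<in>Basis. (v \<bullet> e) *\<^sub>R L e)"
  using linear_sum[OF assms, of "\<lambda>e. (v \<bullet> e) *\<^sub>R e" Basis]
  by (simp add: linear_scale[OF assms] euclidean_representation)

lemma isCont_frechet_derivative:
  fixes g :: "'a::euclidean_space \<Rightarrow> 'b::real_normed_vector"
  assumes g: "cont_diff (Suc k) g" and y: "isCont y a" and v: "isCont v a"
  shows "isCont (\<lambda>z. frechet_derivative g (at (y z)) (v z)) a"
proof -
  have c: "isCont (\<lambda>z. frechet_derivative g (at (y z)) e) a" for e
    using cont_diff_continuous[OF cont_diff_SucD(2)[OF g, of e]]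
    by (intro isCont_o2[OF y]) (simp add: continuous_on_eq_continuous_at)
  have "linear (frechet_derivative g (at x))" for x
    by (rule linear_frechet_derivative) (use g in simp)
  then have "(\<lambda>z. frechet_derivative g (at (y z)) (v z)) =
      (\<lambda>z. \<Sum>e\<in>Basis. (v z \<bullet> e) *\<^sub>R frechet_derivative g (at (y z)) e)"
    by (intro ext linear_eq_sum_Basis)
  then show ?thesis by (simp add: c v continuous_intros)
qed

text \<open>The directional derivatives along the finitely many basis vectors are continuous, which makes
  the derivative continuous in operator norm.\<close>

lemma C1_derivative_close:
  fixes g :: "'a::euclidean_space \<Rightarrow> 'b::real_normed_vector"
  assumes g: "cont_diff (Suc k) g" and "\<eta> > 0"
  shows "\<exists>\<rho>>0. \<forall>x\<in>ball p \<rho>. \<forall>v.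
    norm (frechet_derivative g (at x) v - frechet_derivative g (at p) v) \<le> \<eta> * norm v"
proof -
  let ?D = "\<lambda>x. frechet_derivative g (at x)"
  have lin: "linear (?D x)" for x
    by (rule linear_frechet_derivative) (use g in simp)
  define \<theta> where "\<theta> = \<eta> / DIM('a)"
  have "\<theta> > 0" using \<open>\<eta> > 0\<close> by (simp add: \<theta>_def)
  have "\<forall>\<^sub>F x in nhds p. \<forall>e\<in>Basis. dist (?D x e) (?D p e) < \<theta>"
  proof (rule eventually_ball_finite, simp, rule ballI)
    fix e :: 'a
    have "isCont (\<lambda>x. ?D x e) p"
      by (rule isCont_frechet_derivative[OF g]) auto
    then show "\<forall>\<^sub>F x in nhds p. dist (?D x e) (?D p e) < \<theta>"
      using tendstoD[OF tendsto_at_iff_tendsto_nhds[of "\<lambda>x. ?D x e" p, THEN iffD1] \<open>\<theta> > 0\<close>]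
      by (simp add: isCont_def)
  qed
  then obtain \<rho> where "\<rho> > 0" and \<rho>: "\<And>x e. dist x p < \<rho> \<Longrightarrow> e \<in> Basis \<Longrightarrow> dist (?D x e) (?D p e) < \<theta>"
    unfolding eventually_nhds_metric by blast
  have "norm (?D x v - ?D p v) \<le> \<eta> * norm v" if "x \<in> ball p \<rho>" for x v
  proof -
    have "?D x v - ?D p v = (\<Sum>e\<in>Basis. (v \<bullet> e) *\<^sub>R (?D x e - ?D p e))"
      using linear_eq_sum_Basis[OF lin[of x], of v] linear_eq_sum_Basis[OF lin[of p], of v]
      by (simp add: sum_subtractf scaleR_diff_right)
    also have "norm \<dots> \<le> (\<Sum>e\<in>(Basis::'a set). norm v * \<theta>)"
    proof (rule sum_norm_le)
      fix e :: 'a assume e: "e \<in> Basis"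
      have "norm (?D x e - ?D p e) \<le> \<theta>"
        using \<rho>[of x e] that e by (simp add: dist_norm norm_minus_commute)
      then show "norm ((v \<bullet> e) *\<^sub>R (?D x e - ?D p e)) \<le> norm v * \<theta>"
        using Basis_le_norm[OF e, of v] by (simp add: mult_mono)
    qed
    also have "\<dots> = \<eta> * norm v" by (simp add: \<theta>_def)
    finally show ?thesis .
  qed
  with \<open>\<rho> > 0\<close> show ?thesis by blast
qed

text \<open>Strict differentiability: the mean value inequality for \<open>g\<close> minus its derivative at \<open>p\<close>.\<close>

lemma C1_strict_derivative:
  fixes g :: "'a::euclidean_space \<Rightarrow> 'b::real_normed_vector"
  assumes g: "cont_diff (Suc k) g" and "\<eta> > 0"
  shows "\<exists>\<rho>>0. \<forall>x\<in>ball p \<rho>. \<forall>y\<in>ball p \<rho>.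
    norm (g x - g y - frechet_derivative g (at p) (x - y)) \<le> \<eta> * norm (x - y)"
proof -
  let ?D = "\<lambda>x. frechet_derivative g (at x)"
  obtain \<rho> where "\<rho> > 0" and \<rho>: "\<And>x v. x \<in> ball p \<rho> \<Longrightarrow> norm (?D x v - ?D p v) \<le> \<eta> * norm v"
    using C1_derivative_close[OF assms] by blast
  have d: "((\<lambda>x. g x - ?D p x) has_derivative (\<lambda>v. ?D x v - ?D p v)) (at x within ball p \<rho>)" for x
    by (intro has_derivative_diff has_derivative_at_withinI[OF cont_diff_SucD(1)[OF g]]
        bounded_linear.has_derivative[OF has_derivative_bounded_linear[OF cont_diff_SucD(1)[OF g]]]
        has_derivative_ident)
  have le: "norm ((g x - ?D p x) - (g y - ?D p y)) \<le> \<eta> * norm (x - y)"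
    if "x \<in> ball p \<rho>" "y \<in> ball p \<rho>" for x y
    by (rule differentiable_bound[OF convex_ball d _ that])
       (use \<rho> \<open>\<eta> > 0\<close> in \<open>auto intro!: onorm_bound\<close>)
  have eq: "g x - g y - ?D p (x - y) = (g x - ?D p x) - (g y - ?D p y)" for x y
    unfolding linear_diff[OF has_derivative_linear[OF cont_diff_SucD(1)[OF g]]] by simp
  show ?thesis unfolding eq using \<open>\<rho> > 0\<close> le by blast
qed

lemma C1_derivative_bounded:
  fixes g :: "'a::euclidean_space \<Rightarrow> 'b::real_normed_vector"
  assumes g: "cont_diff (Suc k) g"
  shows "\<exists>M>0. \<exists>\<rho>>0. \<forall>x\<in>ball p \<rho>. \<forall>v. norm (frechet_derivative g (at x) v) \<le> M * norm v"
proof -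
  let ?D = "\<lambda>x. frechet_derivative g (at x)"
  obtain \<rho> where "\<rho> > 0" and \<rho>: "\<And>x v. x \<in> ball p \<rho> \<Longrightarrow> norm (?D x v - ?D p v) \<le> 1 * norm v"
    using C1_derivative_close[OF assms, of 1] by force
  obtain K where "K > 0" and K: "\<And>v. norm (?D p v) \<le> norm v * K"
    using bounded_linear.pos_bounded[OF has_derivative_bounded_linear[OF cont_diff_SucD(1)[OF g]]]
    by blast
  have "norm (?D x v) \<le> (1 + K) * norm v" if "x \<in> ball p \<rho>" for x v
    using \<rho>[OF that, of v] K[of v] norm_triangle_sub[of "?D x v" "?D p v"]
    by (simp add: algebra_simps)
  then show ?thesis using \<open>\<rho> > 0\<close> \<open>K > 0\<close>
    by (intro exI[of _ "1 + K"] conjI exI[of _ \<rho>]) auto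
qed

lemma C1_lipschitz_near:
  fixes g :: "'a::euclidean_space \<Rightarrow> 'b::real_normed_vector"
  assumes g: "cont_diff (Suc k) g"
  shows "\<exists>L>0. \<exists>\<rho>>0. \<forall>x\<in>ball p \<rho>. \<forall>y\<in>ball p \<rho>. norm (g x - g y) \<le> L * norm (x - y)"
proof -
  let ?D = "frechet_derivative g (at p)"
  obtain \<rho> where "\<rho> > 0" and \<rho>: "\<And>x y. x \<in> ball p \<rho> \<Longrightarrow> y \<in> ball p \<rho> \<Longrightarrow>
      norm (g x - g y - ?D (x - y)) \<le> 1 * norm (x - y)"
    using C1_strict_derivative[OF assms, of 1] by force
  obtain K where "K > 0" and K: "\<And>v. norm (?D v) \<le> norm v * K"
    using bounded_linear.pos_bounded[OF has_derivative_bounded_linear[OF cont_diff_SucD(1)[OF g]]]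
    by blast
  have "norm (g x - g y) \<le> (1 + K) * norm (x - y)" if "x \<in> ball p \<rho>" "y \<in> ball p \<rho>" for x y
    using \<rho>[OF that] K[of "x - y"] norm_triangle_sub[of "g x - g y" "?D (x - y)"]
    by (simp add: algebra_simps)
  then show ?thesis using \<open>\<rho> > 0\<close> \<open>K > 0\<close>
    by (intro exI[of _ "1 + K"] conjI exI[of _ \<rho>]) auto
qed


section \<open>The flow of a linear vector field and a quadratic Lyapunov form\<close>

lemma derivative_le_imp_bound:
  fixes \<phi> :: "real \<Rightarrow> real"
  assumes "a \<le> b"
    and d: "\<And>t. t \<in> {a..b} \<Longrightarrow> (\<phi> has_real_derivative \<phi>' t) (at t within {a..b})"
    and le: "\<And>t. t \<in> {a..b} \<Longrightarrow> \<phi>' t \<le> c"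
  shows "\<phi> b \<le> \<phi> a + c * (b - a)"
proof (cases "a = b")
  case False
  then have "a < b" using \<open>a \<le> b\<close> by simp
  obtain t where t: "t \<in> {a<..<b}" "\<phi> b - \<phi> a = \<phi>' t * (b - a)"
    using mvt_simple[OF \<open>a < b\<close>, of \<phi> "\<lambda>t. (*) (\<phi>' t)"] d
    by (auto simp: has_field_derivative_def)
  then have "\<phi>' t * (b - a) \<le> c * (b - a)"
    using le[of t] \<open>a < b\<close> by (intro mult_right_mono) auto
  then show ?thesis using t by linarith
qed simp

text \<open>The flow is the exponential series \<open>\<Sum> t^k A^k v / k!\<close>.  It is differentiated coordinatewise,
  where it is a real power series in \<open>t\<close>.\<close>

lemma linear_flow_exists:
  fixes A :: "'a::euclidean_space \<Rightarrow> 'a"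
  assumes A: "linear A"
  obtains E :: "real \<Rightarrow> 'a \<Rightarrow> 'a" where
    "\<And>v. E 0 v = v" and "\<And>t. linear (E t)" and "\<And>t v. E t (A v) = A (E t v)"
    and "\<And>t v. ((\<lambda>t. E t v) has_vector_derivative A (E t v)) (at t)"
proof -
  obtain a where "a > 0" and a: "\<And>v. norm (A v) \<le> a * norm v"
    using linear_bounded_pos[OF A] by blast
  have Ak: "norm ((A ^^ k) v) \<le> a ^ k * norm v" for k v
  proof (induction k)
    case (Suc k)
    have "norm (A ((A ^^ k) v)) \<le> a * (a ^ k * norm v)"
      using a[of "(A ^^ k) v"] Suc \<open>a > 0\<close>
      by (meson order_trans mult_left_mono less_imp_le)
    then show ?case by (simp add: mult.assoc)
  qed simp
  have linAk: "linear (A ^^ k)" for k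
    by (induction k) (auto simp: linear_id[unfolded id_def] id_def intro: linear_compose[OF _ A, unfolded o_def])
  have bA: "bounded_linear A"
    using A by (rule linear_conv_bounded_linear[THEN iffD1])
  define c where "c v k t = (t ^ k / fact k) *\<^sub>R (A ^^ k) v" for v k and t :: real
  have sm: "summable (\<lambda>k. c v k t)" for v t
  proof (rule summable_comparison_test)
    show "summable (\<lambda>k. (\<bar>t\<bar> * a) ^ k /\<^sub>R fact k * norm v)"
      by (intro summable_mult2 summable_exp_generic)
    show "\<exists>N. \<forall>k\<ge>N. norm (c v k t) \<le> (\<bar>t\<bar> * a) ^ k /\<^sub>R fact k * norm v"
      using Ak by (simp add: c_def power_mult_distrib power_abs divide_simps mult.assoc mult_left_mono)
  qed
  define E where "E t v = (\<Sum>k. c v k t)" for t v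
  have E0: "E 0 v = v" for v
  proof -
    have "E 0 v = (\<Sum>k\<in>{0}. c v k 0)"
      unfolding E_def by (rule suminf_finite) (auto simp: c_def)
    then show ?thesis by (simp add: c_def)
  qed
  have Elin: "linear (E t)" for t
  proof (rule linearI)
    show "E t (v + w) = E t v + E t w" for v w
      unfolding E_def by (subst suminf_add[OF sm sm])
        (simp add: c_def linear_add[OF linAk] scaleR_add_right)
    show "E t (s *\<^sub>R v) = s *\<^sub>R E t v" for s v
      unfolding E_def by (subst suminf_scaleR_right[OF sm])
        (simp add: c_def linear_scale[OF linAk] mult.commute)
  qed
  have EA: "E t (A v) = A (E t v)" for t v
    unfolding E_def bounded_linear.suminf[OF bA sm]
    by (simp add: c_def linear_scale[OF A] funpow_swap1)
  have Ed: "((\<lambda>t. E t v) has_vector_derivative A (E t v)) (at t)" for t v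
  proof -
    have "((\<lambda>t. E t v \<bullet> e) has_real_derivative A (E t v) \<bullet> e) (at t)" for e
    proof -
      define d where "d w k = ((A ^^ k) w \<bullet> e) / fact k" for w k
      have Ee: "E t w \<bullet> e = (\<Sum>k. d w k * t ^ k)" and dsm: "summable (\<lambda>k. d w k * t ^ k)" for t w
        using bounded_linear.suminf[OF bounded_linear_inner_left sm, of w t e]
          bounded_linear.summable[OF bounded_linear_inner_left sm, of w t e]
        by (simp_all add: E_def c_def d_def mult.commute)
      have "diffs (d v) = d (A v)"
        by (auto simp: diffs_def d_def fun_eq_iff funpow_swap1 divide_simps)
      then show ?thesis
        using termdiffs_strong_converges_everywhere[OF dsm, of v t]
        by (simp add: Ee EA[symmetric])
    qed
    then show ?thesis
      unfolding has_vector_derivative_def has_field_derivative_def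
      by (subst has_derivative_componentwise_within) (simp add: mult.commute mult_commute_abs)
  qed
  show ?thesis by (rule that[of E]) (fact E0 Elin EA Ed)+
qed

text \<open>The form is \<open>\<integral> E t v \<bullet> E t w\<close> over \<open>[0, T]\<close>: its derivative along the linear flow is the
  integral of a derivative, so that one contraction estimate at the single time \<open>T\<close> replaces an improper
  integral.\<close>

lemma quadratic_lyapunov_form:
  fixes A :: "'a::euclidean_space \<Rightarrow> 'a"
  assumes A: "linear A"
    and E0: "\<And>v. E 0 v = v" and Elin: "\<And>t. linear (E t)" and EA: "\<And>t v. E t (A v) = A (E t v)"
    and Ed: "\<And>t v. ((\<lambda>t. E t v) has_vector_derivative A (E t v)) (at t)"
    and "T > 0" and T: "\<And>v. (norm (E T v))\<^sup>2 \<le> 1/2 * (norm v)\<^sup>2"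
  shows "\<exists>B. bounded_bilinear B \<and> (\<forall>v w. B v w = B w v) \<and> (\<forall>v. v \<noteq> 0 \<longrightarrow> B v v > (0::real)) \<and>
    (\<forall>v. 2 * B v (A v) \<le> - 1/2 * (norm v)\<^sup>2)"
proof -
  define B where "B v w = integral {0..T} (\<lambda>t. E t v \<bullet> E t w)" for v w
  have cE: "continuous_on S (\<lambda>t. E t v)" for S v
    using Ed has_vector_derivative_continuous continuous_at_imp_continuous_on by blast
  have int: "(\<lambda>t. E t v \<bullet> E t w) integrable_on {0..T}" for v w
    by (intro integrable_continuous_real continuous_on_inner cE)
  have "bilinear B"
    unfolding bilinear_def B_def
    by (auto intro!: linearI simp: linear_add[OF Elin] linear_scale[OF Elin] inner_add_left
        inner_add_right Henstock_Kurzweil_Integration.integral_add[OF int int])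
  then have bil: "bounded_bilinear B"
    by (simp add: bilinear_conv_bounded_bilinear)
  have pos: "B v v > 0" if "v \<noteq> 0" for v
  proof -
    have "B v v \<noteq> 0"
    proof
      assume "B v v = 0"
      then have "\<forall>t\<in>{0..T}. E t v \<bullet> E t v = 0"
        unfolding B_def
        by (subst (asm) integral_eq_0_iff) (auto intro!: continuous_on_inner cE \<open>T > 0\<close>)
      then show False using \<open>T > 0\<close> E0[of v] that by auto
    qed
    moreover have "B v v \<ge> 0"
      unfolding B_def by (intro Henstock_Kurzweil_Integration.integral_nonneg int) auto
    ultimately show ?thesis by simp
  qed
  have dec: "2 * B v (A v) \<le> - 1/2 * (norm v)\<^sup>2" for v
  proof -
    have "((\<lambda>t. 2 * (E t v \<bullet> E t (A v))) has_integral E T v \<bullet> E T v - E 0 v \<bullet> E 0 v) {0..T}"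
    proof (rule fundamental_theorem_of_calculus)
      fix t
      have "((\<lambda>t. E t v \<bullet> E t v) has_vector_derivative E t v \<bullet> A (E t v) + A (E t v) \<bullet> E t v) (at t)"
        by (rule bounded_bilinear.has_vector_derivative[OF bounded_bilinear_inner Ed Ed])
      then show "((\<lambda>t. E t v \<bullet> E t v) has_vector_derivative 2 * (E t v \<bullet> E t (A v)))
          (at t within {0..T})"
        by (simp add: EA inner_commute has_vector_derivative_at_within)
    qed (use \<open>T > 0\<close> in simp)
    then have "2 * B v (A v) = (norm (E T v))\<^sup>2 - (norm v)\<^sup>2"
      unfolding B_def integral_mult_right[symmetric]
      by (simp only: integral_unique E0 power2_norm_eq_inner)
    then show ?thesis using T[of v] by simp
  qed
  show ?thesis
    using bil pos dec by (intro exI[of _ B]) (auto simp: B_def inner_commute)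
qed

text \<open>Scaled trajectories \<open>(\<xi> - p) / \<delta>\<close> started at \<open>p + \<delta> v\<close> inherit the exponential bound with the
  same constants, and converge to the trajectory of the linearization as \<open>\<delta>\<close> tends to zero.  The
  distance is controlled by a differential inequality for its square.\<close>

lemma linearization_of_exponentially_stable:
  fixes g A :: "'a::euclidean_space \<Rightarrow> 'a"
  assumes gd: "(g has_derivative A) (at p)" and "g p = 0"
    and ex: "\<And>x0. \<exists>\<xi>. solves g UNIV {0..} \<xi> \<and> \<xi> 0 = x0"
    and "k > 0" and "c > 0"
    and bd: "\<And>\<xi> t. solves g UNIV {0..} \<xi> \<Longrightarrow> t \<ge> 0 \<Longrightarrow>
        norm (\<xi> t - p) \<le> k * norm (\<xi> 0 - p) * exp (- c * t)"
    and E0: "E 0 v = v"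
    and Ed: "\<And>t. ((\<lambda>t. E t v) has_vector_derivative A (E t v)) (at t)"
    and "T \<ge> 0"
  shows "norm (E T v) \<le> k * norm v * exp (- c * T)"
proof -
  have linA: "linear A"
    using gd has_derivative_linear by blast
  obtain a where "a > 0" and a: "\<And>v. norm (A v) \<le> a * norm v"
    using linear_bounded_pos[OF linA] by blast
  define m where "m = 2 * a + 1"
  define C where "C = k * norm v * sqrt (T * exp (m * T))"
  have key: "norm (E T v) \<le> k * norm v * exp (- c * T) + \<eta> * C" if "\<eta> > 0" for \<eta>
  proof -
    obtain d where "d > 0" and d: "\<And>y. norm (y - p) < d \<Longrightarrow> norm (g y - A (y - p)) \<le> \<eta> * norm (y - p)"
      using gd \<open>g p = 0\<close> \<open>\<eta> > 0\<close> unfolding has_derivative_at_alt by (metis diff_zero)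
    have kv: "k * norm v \<ge> 0" using \<open>k > 0\<close> by simp
    define X where "X = k * norm v + 1"
    have "X > 0" using kv by (simp add: X_def)
    define \<delta> where "\<delta> = d / (2 * X)"
    have "\<delta> > 0" using \<open>d > 0\<close> \<open>X > 0\<close> by (simp add: \<delta>_def)
    have \<delta>d: "k * (\<delta> * norm v) < d"
    proof -
      have "k * (\<delta> * norm v) \<le> \<delta> * X" unfolding X_def using \<open>\<delta> > 0\<close> by (simp add: algebra_simps)
      also have "\<dots> = d / 2" using \<open>X > 0\<close> by (simp add: \<delta>_def)
      finally show ?thesis using \<open>d > 0\<close> by simp
    qed
    obtain \<xi> where \<xi>: "solves g UNIV {0..} \<xi>" and \<xi>0: "\<xi> 0 = p + \<delta> *\<^sub>R v"
      using ex by blast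
    have \<xi>n: "norm (\<xi> t - p) \<le> \<delta> * (k * norm v * exp (- c * t))" if "t \<ge> 0" for t
      using bd[OF \<xi> that] \<open>\<delta> > 0\<close> by (simp add: \<xi>0 mult_ac)
    have \<xi>n': "norm (\<xi> t - p) \<le> \<delta> * (k * norm v)" if "t \<ge> 0" for t
    proof -
      have "k * norm v * exp (- c * t) \<le> k * norm v"
        using kv \<open>c > 0\<close> that by (simp add: mult_left_le)
      then show ?thesis using \<xi>n[OF that] \<open>\<delta> > 0\<close> by (meson mult_left_mono order_trans less_imp_le)
    qed
    define y where "y t = (\<xi> t - p) /\<^sub>R \<delta>" for t
    define R where "R t = g (\<xi> t) /\<^sub>R \<delta> - A (y t)" for t
    define D where "D t = y t - E t v" for t
    have yd: "(y has_vector_derivative A (y t) + R t) (at t within {0..T})" if "t \<in> {0..T}" for t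
    proof -
      have "(\<xi> has_vector_derivative g (\<xi> t)) (at t within {0..T})"
        using \<xi> that has_vector_derivative_within_subset[of \<xi> _ t "{0..}" "{0..T}"]
        by (auto simp: solves_def)
      then show ?thesis
        unfolding y_def[abs_def] R_def
        by (auto intro!: derivative_eq_intros)
    qed
    have Rn: "norm (R t) \<le> \<eta> * (k * norm v)" if "t \<ge> 0" for t
    proof -
      have R: "R t = (g (\<xi> t) - A (\<xi> t - p)) /\<^sub>R \<delta>"
        unfolding R_def y_def linear_scale[OF linA] by (simp only: scaleR_diff_right)
      have "norm (\<xi> t - p) < d"
        using \<xi>n'[OF that] \<delta>d by (simp add: mult_ac)
      then have "norm (g (\<xi> t) - A (\<xi> t - p)) \<le> \<eta> * (\<delta> * (k * norm v))"
        using d \<xi>n'[OF that] \<open>\<eta> > 0\<close> by (meson mult_left_mono order_trans less_imp_le)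
      then show ?thesis using \<open>\<delta> > 0\<close> unfolding R norm_scaleR by (simp add: field_simps)
    qed
    have Dd: "(D has_vector_derivative A (D t) + R t) (at t within {0..T})" if "t \<in> {0..T}" for t
      unfolding D_def[abs_def] linear_diff[OF linA]
      using has_vector_derivative_diff[OF yd[OF that] has_vector_derivative_at_within[OF Ed]]
      by (simp add: algebra_simps)
    \<comment> \<open>the factor \<open>exp (- m * t)\<close> absorbs the linear part of the growth of the squared distance\<close>
    define \<psi> where "\<psi> t = exp (- m * t) * (D t \<bullet> D t) - (\<eta> * (k * norm v))\<^sup>2 * t" for t
    define \<psi>' where "\<psi>' t = exp (- m * t) * (2 * (D t \<bullet> (A (D t) + R t)) - m * (D t \<bullet> D t))
        - (\<eta> * (k * norm v))\<^sup>2" for t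
    have \<psi>d: "(\<psi> has_real_derivative \<psi>' t) (at t within {0..T})" if "t \<in> {0..T}" for t
    proof -
      have "((\<lambda>t. D t \<bullet> D t) has_real_derivative 2 * (D t \<bullet> (A (D t) + R t))) (at t within {0..T})"
        using bounded_bilinear.has_vector_derivative[OF bounded_bilinear_inner Dd[OF that] Dd[OF that]]
        by (simp add: has_real_derivative_iff_has_vector_derivative inner_commute)
      then show ?thesis
        unfolding \<psi>_def[abs_def] \<psi>'_def
        by (auto intro!: derivative_eq_intros simp: algebra_simps)
    qed
    have \<psi>neg: "\<psi>' t \<le> 0" if "t \<in> {0..T}" for t
    proof -
      have t: "t \<ge> 0" using that by simp
      have "D t \<bullet> A (D t) \<le> norm (D t) * norm (A (D t))" by (rule norm_cauchy_schwarz)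
      also have "\<dots> \<le> norm (D t) * (a * norm (D t))" by (intro mult_left_mono a) simp
      also have "\<dots> = a * (D t \<bullet> D t)" by (simp add: power2_norm_eq_inner[symmetric] power2_eq_square)
      finally have 1: "2 * (D t \<bullet> A (D t)) \<le> 2 * a * (D t \<bullet> D t)" by simp
      have "0 \<le> (D t - R t) \<bullet> (D t - R t)" by simp
      then have 2: "2 * (D t \<bullet> R t) \<le> D t \<bullet> D t + (norm (R t))\<^sup>2"
        by (simp add: power2_norm_eq_inner inner_diff_left inner_diff_right inner_commute)
      have 3: "(norm (R t))\<^sup>2 \<le> (\<eta> * (k * norm v))\<^sup>2"
        by (rule power_mono[OF Rn[OF t]]) simp
      have "m * t \<ge> 0" using t \<open>a > 0\<close> by (simp add: m_def)
      then have "exp (- m * t) \<le> 1" by simp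
      have "2 * (D t \<bullet> (A (D t) + R t)) - m * (D t \<bullet> D t) \<le> (\<eta> * (k * norm v))\<^sup>2"
        using 1 2 3 by (simp add: m_def inner_add_right algebra_simps)
      then have "exp (- m * t) * (2 * (D t \<bullet> (A (D t) + R t)) - m * (D t \<bullet> D t)) \<le>
          exp (- m * t) * (\<eta> * (k * norm v))\<^sup>2"
        by (rule mult_left_mono) simp
      also have "\<dots> \<le> (\<eta> * (k * norm v))\<^sup>2"
        using mult_right_mono[OF \<open>exp (- m * t) \<le> 1\<close>, of "(\<eta> * (k * norm v))\<^sup>2"] by simp
      finally show ?thesis by (simp add: \<psi>'_def)
    qed
    have "\<psi> T \<le> \<psi> 0"
      using derivative_le_imp_bound[OF \<open>T \<ge> 0\<close> \<psi>d \<psi>neg] by simp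
    have "D 0 = 0" using \<open>\<delta> > 0\<close> by (simp add: D_def y_def \<xi>0 E0)
    with \<open>\<psi> T \<le> \<psi> 0\<close> have "exp (- m * T) * (norm (D T))\<^sup>2 \<le> (\<eta> * (k * norm v))\<^sup>2 * T"
      by (simp add: \<psi>_def power2_norm_eq_inner)
    then have "(norm (D T))\<^sup>2 \<le> (\<eta> * (k * norm v))\<^sup>2 * (T * exp (m * T))"
      by (simp add: exp_minus field_simps)
    also have "\<dots> = (\<eta> * C)\<^sup>2"
      using \<open>T \<ge> 0\<close> by (simp add: C_def power_mult_distrib)
    finally have "norm (D T) \<le> \<eta> * C"
      by (rule power2_le_imp_le) (use \<open>\<eta> > 0\<close> kv \<open>T \<ge> 0\<close> in \<open>simp add: C_def\<close>)
    moreover have "norm (y T) \<le> k * norm v * exp (- c * T)"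
      using \<xi>n[OF \<open>T \<ge> 0\<close>] \<open>\<delta> > 0\<close> unfolding y_def norm_scaleR by (simp add: field_simps)
    moreover have "norm (E T v) \<le> norm (y T) + norm (D T)"
      using norm_triangle_ineq4[of "y T" "D T"] by (simp add: D_def)
    ultimately show ?thesis by linarith
  qed
  have "((\<lambda>\<eta>. k * norm v * exp (- c * T) + \<eta> * C) \<longlongrightarrow> k * norm v * exp (- c * T) + 0 * C) (at_right 0)"
    by (intro tendsto_intros)
  moreover have "\<forall>\<^sub>F \<eta> in at_right 0. norm (E T v) \<le> k * norm v * exp (- c * T) + \<eta> * C"
    using eventually_at_right_less by (rule eventually_mono) (rule key)
  ultimately have "norm (E T v) \<le> k * norm v * exp (- c * T) + 0 * C"
    by (rule tendsto_lowerbound) simp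
  then show ?thesis by simp
qed


section \<open>Projection onto a half-space and the Karush-Kuhn-Tucker condition\<close>

text \<open>For \<open>a \<noteq> 0\<close> this is the orthogonal projection of \<open>p\<close> onto the half-space
  \<open>{q. a \<bullet> q + s \<ge> 0}\<close>.  For \<open>a = 0\<close> the quotient is zero by the convention of division by zero and
  the value is \<open>p\<close>, which is again the projection as soon as \<open>s \<ge> 0\<close>.\<close>

definition halfspace_multiplier :: "'a::real_inner \<Rightarrow> real \<Rightarrow> 'a \<Rightarrow> real" where
  "halfspace_multiplier a s p = max 0 (- (s + a \<bullet> p) / (norm a)\<^sup>2)"

definition halfspace_proj :: "'a::real_inner \<Rightarrow> real \<Rightarrow> 'a \<Rightarrow> 'a" where
  "halfspace_proj a s p = p + halfspace_multiplier a s p *\<^sub>R a"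

lemma halfspace_multiplier_nonneg: "halfspace_multiplier a s p \<ge> 0"
  by (simp add: halfspace_multiplier_def)

lemma halfspace_proj_feasible:
  assumes "a \<noteq> 0 \<or> s \<ge> 0"
  shows "a \<bullet> halfspace_proj a s p + s \<ge> 0"
proof (cases "a = 0")
  case False
  then have n: "(norm a)\<^sup>2 > 0" by simp
  have "- (s + a \<bullet> p) / (norm a)\<^sup>2 * (norm a)\<^sup>2 \<le> halfspace_multiplier a s p * (norm a)\<^sup>2"
    by (rule mult_right_mono) (simp_all add: halfspace_multiplier_def)
  then show ?thesis
    using n by (simp add: halfspace_proj_def inner_add_right power2_norm_eq_inner[symmetric])
qed (use assms in \<open>simp add: halfspace_proj_def\<close>)

lemma halfspace_proj_complementary:
  "halfspace_multiplier a s p * (a \<bullet> halfspace_proj a s p + s) = 0"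
proof (cases "halfspace_multiplier a s p = 0")
  case False
  then have "halfspace_multiplier a s p = - (s + a \<bullet> p) / (norm a)\<^sup>2" and "a \<noteq> 0"
    by (auto simp: halfspace_multiplier_def max_def split: if_splits)
  then have "a \<bullet> halfspace_proj a s p + s = 0"
    by (simp add: halfspace_proj_def inner_add_right power2_norm_eq_inner[symmetric])
  then show ?thesis by simp
qed simp

lemma halfspace_proj_minimal:
  assumes "a \<bullet> q + s \<ge> 0"
  shows "(norm (halfspace_proj a s p - p))\<^sup>2 + (norm (q - halfspace_proj a s p))\<^sup>2 \<le> (norm (q - p))\<^sup>2"
proof -
  define m where "m = halfspace_multiplier a s p"
  define y where "y = halfspace_proj a s p"
  have y: "y - p = m *\<^sub>R a" by (simp add: y_def m_def halfspace_proj_def)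
  have "m * (a \<bullet> q + s) \<ge> 0"
    using assms by (simp add: m_def halfspace_multiplier_nonneg)
  then have "(q - y) \<bullet> (y - p) \<ge> 0"
    using halfspace_proj_complementary[of a s p]
    by (simp add: y m_def[symmetric] y_def[symmetric] inner_diff_left inner_commute[of _ a] algebra_simps)
  moreover have "(norm (q - p))\<^sup>2 = (norm (y - p))\<^sup>2 + (norm (q - y))\<^sup>2 + 2 * ((q - y) \<bullet> (y - p))"
    by (simp add: power2_norm_eq_inner inner_diff_left inner_diff_right inner_commute algebra_simps)
  ultimately show ?thesis by (simp add: y_def)
qed

text \<open>For \<open>s \<ge> 0\<close> the origin is feasible, so the angle at the projection between \<open>p\<close> and the origin is not
  acute.  With \<open>p\<close> a negative multiple of a gradient this is the descent property.\<close>

lemma halfspace_proj_descent: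
  assumes "s \<ge> 0"
  shows "(norm (halfspace_proj a s p))\<^sup>2 \<le> p \<bullet> halfspace_proj a s p"
proof -
  define m where "m = halfspace_multiplier a s p"
  define y where "y = halfspace_proj a s p"
  have p: "p = y - m *\<^sub>R a" by (simp add: y_def m_def halfspace_proj_def)
  have "m * (a \<bullet> y + s) = 0"
    using halfspace_proj_complementary[of a s p] by (simp add: m_def y_def)
  moreover have "m * s \<ge> 0" using assms by (simp add: m_def halfspace_multiplier_nonneg)
  ultimately have "m * (a \<bullet> y) \<le> 0" by (simp add: algebra_simps)
  then have "y \<bullet> y \<le> p \<bullet> y"
    by (simp add: p inner_diff_left)
  then show ?thesis by (simp add: y_def power2_norm_eq_inner)
qed

text \<open>Where the projected negative gradient vanishes, the Karush-Kuhn-Tucker condition holds with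
  \<open>l\<close> as the multiplier, and conversely.\<close>

lemma halfspace_proj_eq_0_iff:
  assumes "s \<ge> 0"
  shows "halfspace_proj a s p = 0 \<longleftrightarrow> (\<exists>l\<ge>0. p = - l *\<^sub>R a \<and> l * s = 0)"
proof
  assume 0: "halfspace_proj a s p = 0"
  then have "p = - halfspace_multiplier a s p *\<^sub>R a"
    by (simp add: halfspace_proj_def add_eq_0_iff2)
  moreover have "halfspace_multiplier a s p * s = 0"
    using halfspace_proj_complementary[of a s p] 0 by simp
  ultimately show "\<exists>l\<ge>0. p = - l *\<^sub>R a \<and> l * s = 0"
    using halfspace_multiplier_nonneg by blast
next
  assume "\<exists>l\<ge>0. p = - l *\<^sub>R a \<and> l * s = 0"
  then obtain l where l: "l \<ge> 0" "p = - l *\<^sub>R a" "l * s = 0" by blast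
  have "(norm (halfspace_proj a s p - p))\<^sup>2 + (norm (0 - halfspace_proj a s p))\<^sup>2 \<le> (norm (0 - p))\<^sup>2"
    by (rule halfspace_proj_minimal) (use assms in simp)
  moreover have "l * (a \<bullet> halfspace_proj a s p + s) \<ge> 0"
    using halfspace_proj_feasible[of a s p] l(1) assms by simp
  then have "p \<bullet> halfspace_proj a s p \<le> 0"
    using l by (simp add: algebra_simps)
  ultimately show "halfspace_proj a s p = 0"
    using halfspace_proj_descent[OF assms, of a p] by (metis norm_le_zero_iff order_trans zero_le_power2 power2_eq_iff_nonneg zero_eq_power2 antisym)
qed

text \<open>The closed form can be discontinuous only where \<open>a\<close> vanishes and the constraint is violated or
  active at \<open>p\<close>.\<close>

lemma isCont_halfspace_proj:
  fixes a p :: "'z::t2_space \<Rightarrow> 'a::real_inner"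
  assumes a: "isCont a z" and s: "isCont s z" and p: "isCont p z"
    and reg: "a z \<noteq> 0 \<or> s z + a z \<bullet> p z > 0"
  shows "isCont (\<lambda>z. halfspace_proj (a z) (s z) (p z)) z"
proof (cases "a z = 0")
  case False
  then show ?thesis
    unfolding halfspace_proj_def halfspace_multiplier_def
    by (intro continuous_intros a s p) simp
next
  case True
  have lim: "((\<lambda>z. s z + a z \<bullet> p z) \<longlongrightarrow> s z + a z \<bullet> p z) (nhds z)"
    using a s p by (intro tendsto_intros) (simp_all add: isCont_def tendsto_at_iff_tendsto_nhds)
  have "\<forall>\<^sub>F y in nhds z. s y + a y \<bullet> p y > 0"
    using order_tendstoD(1)[OF lim, of 0] reg True by simp
  then have "\<forall>\<^sub>F y in nhds z. p y = halfspace_proj (a y) (s y) (p y)"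
    by eventually_elim
      (auto simp: halfspace_proj_def halfspace_multiplier_def max_def divide_le_0_iff not_le
         zero_le_divide_iff)
  then show ?thesis
    using isCont_cong p by fast
qed

text \<open>If the projected negative gradient did not vanish, tilting it slightly into the feasible side
  would give a direction that is both strictly feasible and strictly decreasing.\<close>

lemma local_min_KKT:
  fixes \<phi> b :: "'a::euclidean_space \<Rightarrow> real"
  assumes \<phi>: "(\<phi> has_derivative (\<lambda>v. d \<bullet> v)) (at u)" and b: "(b has_derivative (\<lambda>v. a \<bullet> v)) (at u)"
    and "b u \<ge> 0" and reg: "b u = 0 \<Longrightarrow> a \<noteq> 0"
    and min: "\<forall>\<^sub>F y in nhds u. b y \<ge> 0 \<longrightarrow> \<phi> u \<le> \<phi> y"
  shows "\<exists>l\<ge>0. d = l *\<^sub>R a \<and> l * b u = 0"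
proof -
  have dir: "\<forall>\<^sub>F t in at_right 0. g (u + t *\<^sub>R v) > g u"
    if g: "(g has_derivative (\<lambda>v. c \<bullet> v)) (at u)" and "c \<bullet> v > 0" for g :: "'a \<Rightarrow> real" and c v
  proof -
    have "((\<lambda>t. g (u + t *\<^sub>R v)) has_real_derivative c \<bullet> v) (at 0)"
      unfolding has_field_derivative_def
      by (rule has_derivative_eq_rhs[OF has_derivative_compose[of "\<lambda>t. u + t *\<^sub>R v" "\<lambda>t. t *\<^sub>R v" 0 UNIV g "\<lambda>v. c \<bullet> v"]])
         (auto intro!: derivative_eq_intros g simp: mult.commute)
    from DERIV_pos_inc_right[OF this \<open>c \<bullet> v > 0\<close>]
    show ?thesis unfolding eventually_at_right_field by force
  qed
  have line: "filterlim (\<lambda>t. u + t *\<^sub>R v) (nhds u) (at_right 0)" for v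
    by (rule tendsto_eq_intros refl | simp)+
  have no_dir: False if "d \<bullet> v < 0" and bv: "b u = 0 \<Longrightarrow> a \<bullet> v > 0" for v
  proof -
    have "((\<lambda>x. - \<phi> x) has_derivative (\<lambda>v. (- d) \<bullet> v)) (at u)"
      using has_derivative_minus[OF \<phi>] by simp
    from dir[OF this, of v] have "\<forall>\<^sub>F t in at_right 0. \<phi> (u + t *\<^sub>R v) < \<phi> u"
      using \<open>d \<bullet> v < 0\<close> by simp
    moreover have "\<forall>\<^sub>F t in at_right 0. b (u + t *\<^sub>R v) \<ge> 0"
    proof (cases "b u = 0")
      case True
      show ?thesis using dir[OF b bv[OF True]] by eventually_elim (simp add: True)
    next
      case False
      have "((\<lambda>t. b (u + t *\<^sub>R v)) \<longlongrightarrow> b u) (at_right 0)"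
        using line has_derivative_continuous[OF b]
        unfolding isCont_def tendsto_at_iff_tendsto_nhds by (rule filterlim_compose[rotated])
      then have "\<forall>\<^sub>F t in at_right 0. b (u + t *\<^sub>R v) > 0"
        using False \<open>b u \<ge> 0\<close> by (intro order_tendstoD) auto
      then show ?thesis by eventually_elim simp
    qed
    moreover have "\<forall>\<^sub>F t in at_right 0. b (u + t *\<^sub>R v) \<ge> 0 \<longrightarrow> \<phi> u \<le> \<phi> (u + t *\<^sub>R v)"
      using min line by (rule eventually_compose_filterlim)
    ultimately have "\<forall>\<^sub>F t in at_right (0::real). False"
      by eventually_elim auto
    then show False by simp
  qed
  show ?thesis
  proof (cases "b u = 0")
    case False
    have "d = 0"
    proof (rule ccontr)
      assume "d \<noteq> 0"
      then have "d \<bullet> (- d) < 0" by simp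
      from no_dir[OF this] False show False by blast
    qed
    then show ?thesis by (intro exI[of _ 0]) simp
  next
    case True
    define q where "q = halfspace_proj a 0 (- d)"
    have "q = 0"
    proof (rule ccontr)
      assume "q \<noteq> 0"
      then have "d \<bullet> q < 0"
        using halfspace_proj_descent[of 0 a "- d"] unfolding q_def[symmetric]
        by (smt (verit) inner_minus_left zero_less_norm_iff zero_less_power)
      define \<delta> where "\<delta> = - (d \<bullet> q) / (2 * (\<bar>d \<bullet> a\<bar> + 1))"
      have "\<delta> > 0" using \<open>d \<bullet> q < 0\<close> by (simp add: \<delta>_def divide_neg_pos)
      have "\<delta> * (d \<bullet> a) \<le> \<delta> * (\<bar>d \<bullet> a\<bar> + 1)" using \<open>\<delta> > 0\<close> by simp
      also have "\<dots> = - (d \<bullet> q) / 2" unfolding \<delta>_def by (simp add: field_simps)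
      finally have "d \<bullet> (q + \<delta> *\<^sub>R a) < 0"
        using \<open>d \<bullet> q < 0\<close> by (simp add: inner_add_right)
      moreover have "a \<bullet> (q + \<delta> *\<^sub>R a) > 0"
        using halfspace_proj_feasible[of a 0 "- d"] reg[OF True] \<open>\<delta> > 0\<close>
        by (simp add: q_def inner_add_right add_nonneg_pos)
      ultimately show False by (rule no_dir)
    qed
    then show ?thesis
      using halfspace_proj_eq_0_iff[of 0 a "- d"] True by (auto simp: q_def)
  qed
qed


section \<open>Continuation of solutions\<close>

text \<open>The right-open initial segments of the half-line.  They are relatively open in \<open>{0..}\<close>, which
  makes being a solution a local property, and nonempty unions of them are of the same kind.\<close>

definition initial_segment :: "real set \<Rightarrow> bool" where
  "initial_segment I \<longleftrightarrow> 0 \<in> I \<and> I \<subseteq> {0..} \<and> (\<forall>t\<in>I. {0..t} \<subseteq> I) \<and> (\<forall>t\<in>I. \<exists>t'\<in>I. t < t')"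

lemma initial_segmentD:
  assumes "initial_segment I"
  shows "0 \<in> I" and "t \<in> I \<Longrightarrow> 0 \<le> t" and "t \<in> I \<Longrightarrow> 0 \<le> s \<Longrightarrow> s \<le> t \<Longrightarrow> s \<in> I"
    and "t \<in> I \<Longrightarrow> \<exists>t'\<in>I. t < t'"
  using assms unfolding initial_segment_def by (blast, blast, force, blast)

lemma initial_segment_atLeastLessThan: "T > 0 \<Longrightarrow> initial_segment {0..<T}"
  unfolding initial_segment_def
proof (intro conjI ballI)
  show "\<exists>t'\<in>{0..<T}. t < t'" if "t \<in> {0..<T}" for t
    by (rule bexI[of _ "(t + T) / 2"]) (use that in auto)
qed auto

lemma initial_segment_atLeast: "initial_segment {0..}"
  unfolding initial_segment_def
proof (intro conjI ballI)
  show "\<exists>t'\<in>{0..}. t < t'" if "t \<in> {0..}" for t :: real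
    by (rule bexI[of _ "t + 1"]) (use that in auto)
qed auto

lemma initial_segment_bounded:
  assumes I: "initial_segment I" and "I \<noteq> {0..}"
  shows "\<exists>T>0. I = {0..<T}"
proof -
  have I': "0 \<in> I" "\<And>t. t \<in> I \<Longrightarrow> 0 \<le> t" "\<And>t s. t \<in> I \<Longrightarrow> 0 \<le> s \<Longrightarrow> s \<le> t \<Longrightarrow> s \<in> I"
    "\<And>t. t \<in> I \<Longrightarrow> \<exists>t'\<in>I. t < t'"
    using initial_segmentD[OF I] by blast+
  obtain u where u: "u \<ge> 0" "u \<notin> I" using \<open>I \<noteq> {0..}\<close> I'(2) by auto
  then have lt: "t < u" if "t \<in> I" for t using I'(3)[OF that, of u] by linarith
  have bdd: "bdd_above I" using lt by (meson bdd_aboveI less_imp_le)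
  have "I = {0..<Sup I}"
  proof (intro equalityI subsetI)
    fix t assume "t \<in> I"
    then obtain t' where "t' \<in> I" "t < t'" using I'(4) by blast
    then show "t \<in> {0..<Sup I}"
      using cSup_upper[OF \<open>t' \<in> I\<close> bdd] \<open>t \<in> I\<close> I'(2) by auto
  next
    fix t assume t: "t \<in> {0..<Sup I}"
    then obtain t' where "t' \<in> I" "t < t'" using less_cSupE[of t I] I'(1) by auto
    then show "t \<in> I" using I'(3)[of t' t] t by simp
  qed
  moreover have "Sup I > 0" using I'(1) calculation by (metis atLeastLessThan_iff)
  ultimately show ?thesis by blast
qed

lemma solves_segment_iff:
  assumes I: "initial_segment I"
  shows "solves F D I z \<longleftrightarrow>
    (\<forall>t\<in>I. z t \<in> D \<and> (z has_vector_derivative F (z t)) (at t within {0..}))"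
proof -
  have "at t within I = at t within {0..}" if t: "t \<in> I" for t
  proof -
    obtain t' where t': "t' \<in> I" "t < t'" using initial_segmentD(4)[OF I t] by blast
    have "I \<inter> {..<t'} = {0..} \<inter> {..<t'}"
      using initial_segmentD(2)[OF I] initial_segmentD(3)[OF I t'(1)] by (auto simp: less_imp_le)
    then show ?thesis
      by (intro at_within_nhd[of t "{..<t'}"]) (use t' in auto)
  qed
  then show ?thesis by (simp add: solves_def)
qed

lemma solves_locally_cong:
  assumes "(z has_vector_derivative x) (at t within {0..})" and "t \<in> {0..<c}"
    and "\<And>s. s \<in> {0..<c} \<Longrightarrow> y s = z s"
  shows "(y has_vector_derivative x) (at t within {0..})"
  by (rule has_vector_derivative_transform_within[OF assms(1), of "c - t"])
     (use assms(2,3) in \<open>auto simp: dist_real_def\<close>)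

text \<open>The velocity is bounded on the compact set, so that the solution extends continuously to the
  end point of its interval of definition; the integral equation shows that it is still a solution
  there, and a local solution from the end point can be appended.\<close>

lemma solution_extension:
  fixes F :: "'a::euclidean_space \<Rightarrow> 'a"
  assumes K: "compact K" "K \<subseteq> D" and F: "continuous_on K F"
    and loc: "\<And>p. p \<in> K \<Longrightarrow> \<exists>T>0. \<exists>z. solves F D {0..<T} z \<and> z 0 = p"
    and "T > 0" and y: "solves F D {0..<T} y" and yK: "\<And>t. t \<in> {0..<T} \<Longrightarrow> y t \<in> K"
  shows "\<exists>T'>T. \<exists>y'. solves F D {0..<T'} y' \<and> (\<forall>t\<in>{0..<T}. y' t = y t)"
proof -
  have "bounded (F ` K)" using K F compact_continuous_image compact_imp_bounded by blast
  then obtain M where M: "M > 0" "\<And>p. p \<in> K \<Longrightarrow> norm (F p) \<le> M"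
    by (auto simp: bounded_pos)
  have yd: "(y has_vector_derivative F (y t)) (at t within {0..<T})" if "t \<in> {0..<T}" for t
    using y that by (auto simp: solves_def)
  have "norm (y s - y t) \<le> M * norm (s - t)" if "s \<in> {0..<T}" "t \<in> {0..<T}" for s t
  proof (rule differentiable_bound[OF _ _ _ that])
    show "convex {0..<T}" by simp
    fix x assume x: "x \<in> {0..<T}"
    show "(y has_derivative (\<lambda>h. h *\<^sub>R F (y x))) (at x within {0..<T})"
      using yd[OF x] by (simp add: has_vector_derivative_def)
    show "onorm (\<lambda>h. h *\<^sub>R F (y x)) \<le> M"
      using M(1) mult_left_mono[OF M(2)[OF yK[OF x]] abs_ge_zero]
      by (intro onorm_bound) (auto simp: mult.commute)
  qed
  then have "M-lipschitz_on {0..<T} y"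
    using M by (auto simp: lipschitz_on_def dist_norm)
  from uniformly_continuous_on_extension_on_closure[OF lipschitz_on_uniformly_continuous[OF this]]
  obtain Y where Y: "uniformly_continuous_on (closure {0..<T}) Y"
    and Yy: "\<And>t. t \<in> {0..<T} \<Longrightarrow> y t = Y t" by metis
  have cl: "closure {0..<T} = {0..T}" using \<open>T > 0\<close> by simp
  have Yc: "continuous_on {0..T} Y"
    using uniformly_continuous_imp_continuous[OF Y] by (simp add: cl)
  have "Y ` closure {0..<T} \<subseteq> K"
    by (rule image_closure_subset) (use Yc K yK Yy in \<open>auto simp: cl compact_imp_closed\<close>)
  then have YK: "Y t \<in> K" if "t \<in> {0..T}" for t using that by (auto simp: cl)
  have FYc: "continuous_on {0..T} (\<lambda>t. F (Y t))"
    by (rule continuous_on_compose2[OF F Yc]) (use YK in auto)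
  have int: "Y t = Y 0 + integral {0..t} (\<lambda>t. F (Y t))" if t: "t \<in> {0..T}" for t
  proof -
    have "((\<lambda>t. F (Y t)) has_integral Y t - Y 0) {0..t}"
    proof (rule fundamental_theorem_of_calculus_interior)
      show "0 \<le> t" using t by simp
      show "continuous_on {0..t} Y" by (rule continuous_on_subset[OF Yc]) (use t in auto)
      fix x assume x: "x \<in> {0<..<t}"
      then have x': "x \<in> {0<..<T}" using t by auto
      have "(y has_vector_derivative F (y x)) (at x within {0<..<T})"
        by (rule has_vector_derivative_within_subset[OF yd]) (use x' in auto)
      moreover have "at x within {0<..<T} = at x" by (rule at_within_open[OF x']) simp
      moreover have "y x = Y x" using x' by (intro Yy) auto
      ultimately have "(y has_vector_derivative F (Y x)) (at x)" by (simp only:)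
      then show "(Y has_vector_derivative F (Y x)) (at x)"
        by (rule has_vector_derivative_transform_within_open[where S = "{0<..<T}"])
           (use x' Yy in auto)
    qed
    from integral_unique[OF this] show ?thesis by (simp add: algebra_simps)
  qed
  have Yd: "(Y has_vector_derivative F (Y t)) (at t within {0..T})" if t: "t \<in> {0..T}" for t
  proof -
    have "((\<lambda>u. Y 0 + integral {0..u} (\<lambda>t. F (Y t))) has_vector_derivative 0 + F (Y t)) (at t within {0..T})"
      by (intro has_vector_derivative_add has_vector_derivative_const
          integral_has_vector_derivative[OF FYc t])
    from has_vector_derivative_transform[OF t int this] show ?thesis by simp
  qed
  obtain \<tau> z where "\<tau> > 0" and z: "solves F D {0..<\<tau>} z" and z0: "z 0 = Y T"
    using loc[OF YK[of T]] \<open>T > 0\<close> by auto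
  have zd: "((\<lambda>t. z (t - T)) has_vector_derivative F (z (t - T))) (at t within {T..<T + \<tau>})"
    if "t \<in> {T..<T + \<tau>}" for t
  proof -
    have 1: "((\<lambda>t. t - T) has_vector_derivative 1) (at t within {T..<T + \<tau>})"
      by (auto intro!: derivative_eq_intros)
    have 2: "(z has_vector_derivative F (z (t - T))) (at (t - T) within (\<lambda>t. t - T) ` {T..<T + \<tau>})"
      by (rule has_vector_derivative_within_subset[of _ _ _ "{0..<\<tau>}"])
         (use z that in \<open>auto simp: solves_def\<close>)
    show ?thesis
      using vector_diff_chain_within[OF 1 2] by (simp add: o_def)
  qed
  define y' where "y' t = (if t \<in> {0..T} then Y t else z (t - T))" for t
  have un: "{0..<T + \<tau>} = {0..T} \<union> {T..<T + \<tau>}" using \<open>T > 0\<close> \<open>\<tau> > 0\<close> by auto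
  have cl2: "closure {0..T} = {0..T}" "closure {T..<T + \<tau>} = {T..T + \<tau>}"
    using \<open>\<tau> > 0\<close> by simp_all
  have mid: "{0..T} \<union> ({0..T} \<inter> {T..T + \<tau>}) = {0..T}"
    "{T..<T + \<tau>} \<union> ({0..T} \<inter> {T..T + \<tau>}) = {T..<T + \<tau>}"
    using \<open>T > 0\<close> \<open>\<tau> > 0\<close> by auto
  have "(y' has_vector_derivative F (y' t)) (at t within {0..<T + \<tau>})" if t: "t \<in> {0..<T + \<tau>}" for t
  proof -
    have "(y' has_vector_derivative (if t \<in> {0..T} then F (Y t) else F (z (t - T))))
        (at t within {0..<T + \<tau>})"
      unfolding y'_def[abs_def]
    proof (rule has_vector_derivative_If_within_closures[of t "{0..T}" "{T..<T + \<tau>}" _ Y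
            "\<lambda>t. F (Y t)" "\<lambda>t. z (t - T)" "\<lambda>t. F (z (t - T))"], unfold cl2 mid)
      show "t \<in> {0..T} \<union> {T..<T + \<tau>}" using t un by blast
    qed (use un Yd zd z0 in auto)
    then show ?thesis by (cases "t \<in> {0..T}") (simp_all only: y'_def if_True if_False)
  qed
  moreover have "y' t \<in> D" if "t \<in> {0..<T + \<tau>}" for t
  proof (cases "t \<in> {0..T}")
    case True
    then show ?thesis using YK[OF True] K(2) unfolding y'_def by auto
  next
    case False
    then have "t - T \<in> {0..<\<tau>}" using that by auto
    then have "z (t - T) \<in> D" using z unfolding solves_def by blast
    with False show ?thesis unfolding y'_def by (simp only: if_False)
  qed
  ultimately have "solves F D {0..<T + \<tau>} y'" unfolding solves_def by blast
  moreover have "\<forall>t\<in>{0..<T}. y' t = y t" using Yy unfolding y'_def by simp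
  moreover have "T + \<tau> > T" using \<open>\<tau> > 0\<close> by simp
  ultimately show ?thesis by blast
qed

text \<open>The local existence times need not be bounded below, so that a maximal solution is taken.
  Zorn's lemma is applied to graphs, for which extension is inclusion.\<close>

lemma global_solution_exists:
  fixes F :: "'a::euclidean_space \<Rightarrow> 'a"
  assumes K: "compact K" "K \<subseteq> D" and F: "continuous_on K F" and "z0 \<in> K"
    and loc: "\<And>p. p \<in> K \<Longrightarrow> \<exists>T>0. \<exists>z. solves F D {0..<T} z \<and> z 0 = p"
    and stay: "\<And>T z t. solves F D {0..<T} z \<Longrightarrow> z 0 = z0 \<Longrightarrow> t \<in> {0..<T} \<Longrightarrow> z t \<in> K"
  shows "\<exists>z. solves F D {0..} z \<and> z 0 = z0"
proof -
  define gr where "gr I y = (\<lambda>t. (t, y t)) ` I" for I :: "real set" and y :: "real \<Rightarrow> 'a"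
  define sol where "sol I y \<longleftrightarrow> initial_segment I \<and> solves F D I y \<and> y 0 = z0" for I y
  define \<G> where "\<G> = {gr I y | I y. sol I y}"
  have "\<G> \<noteq> {}"
    using loc[OF \<open>z0 \<in> K\<close>] initial_segment_atLeastLessThan by (auto simp: \<G>_def sol_def)
  moreover have "\<Union>\<C> \<in> \<G>" if "\<C> \<noteq> {}" and ch: "subset.chain \<G> \<C>" for \<C>
  proof -
    have sv: "a = b" if ab: "(t, a) \<in> \<Union>\<C>" "(t, b) \<in> \<Union>\<C>" for t a b
    proof -
      obtain G where "G \<in> \<C>" "(t, a) \<in> G" "(t, b) \<in> G"
        using ab ch unfolding subset_chain_def by blast
      moreover from this obtain I y where "G = gr I y"
        using ch by (auto simp: \<G>_def subset_chain_def)
      ultimately show ?thesis by (auto simp: gr_def)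
    qed
    define J where "J = fst ` \<Union>\<C>"
    define Y where "Y t = (THE a. (t, a) \<in> \<Union>\<C>)" for t
    have Y: "Y t = a" if "(t, a) \<in> \<Union>\<C>" for t a
      unfolding Y_def using that sv by blast
    have un: "\<Union>\<C> = gr J Y"
      using Y by (force simp: J_def gr_def)
    have piece: "\<exists>I. initial_segment I \<and> t \<in> I \<and> I \<subseteq> J \<and> solves F D I Y \<and> Y 0 = z0" if t: "t \<in> J" for t
    proof -
      obtain G where G: "G \<in> \<C>" "t \<in> fst ` G" using t by (auto simp: J_def)
      then obtain I y where Iy: "G = gr I y" "sol I y"
        using ch by (auto simp: \<G>_def subset_chain_def)
      have seg: "initial_segment I" using Iy by (simp add: sol_def)
      have YI: "Y s = y s" if "s \<in> I" for s
        by (rule Y) (use G Iy that in \<open>auto simp: gr_def\<close>)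
      have "I \<subseteq> J" using G Iy by (force simp: J_def gr_def)
      moreover have "solves F D I Y"
        unfolding solves_segment_iff[OF seg]
      proof
        fix s assume s: "s \<in> I"
        then obtain s' where s': "s' \<in> I" "s < s'" using initial_segmentD(4)[OF seg s] by blast
        have ys: "y s \<in> D" "(y has_vector_derivative F (y s)) (at s within {0..})"
          using Iy s by (auto simp: sol_def solves_segment_iff)
        have "(Y has_vector_derivative F (y s)) (at s within {0..})"
          by (rule solves_locally_cong[OF ys(2), of s'])
             (use s' initial_segmentD(2)[OF seg s] initial_segmentD(3)[OF seg s'(1)] YI in \<open>auto\<close>)
        with ys show "Y s \<in> D \<and> (Y has_vector_derivative F (Y s)) (at s within {0..})"
          by (simp add: YI[OF s])
      qed
      moreover have "0 \<in> I" using seg by (rule initial_segmentD(1))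
      moreover have "t \<in> I" using G Iy by (auto simp: gr_def)
      ultimately show ?thesis using seg Iy YI by (auto simp: sol_def)
    qed
    have "\<exists>t. t \<in> J"
    proof -
      obtain G where "G \<in> \<C>" using \<open>\<C> \<noteq> {}\<close> by blast
      then obtain I y where "G = gr I y" "sol I y"
        using ch by (auto simp: \<G>_def subset_chain_def)
      then have "(0, y 0) \<in> G" using initial_segmentD(1) unfolding sol_def gr_def by blast
      then have "0 \<in> J" unfolding J_def using \<open>G \<in> \<C>\<close> by (metis UnionI fst_conv image_eqI)
      then show ?thesis by blast
    qed
    have seg: "initial_segment J"
      unfolding initial_segment_def
    proof (intro conjI ballI)
      show "0 \<in> J" using piece \<open>\<exists>t. t \<in> J\<close> initial_segmentD(1) by blast
      show "J \<subseteq> {0..}"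
      proof
        fix t assume "t \<in> J"
        then show "t \<in> {0..}" using piece[of t] initial_segmentD(2) by auto
      qed
      show "{0..t} \<subseteq> J" "\<exists>t'\<in>J. t < t'" if t: "t \<in> J" for t
      proof -
        obtain I where I: "initial_segment I" "t \<in> I" "I \<subseteq> J" using piece[OF t] by blast
        show "{0..t} \<subseteq> J" using initial_segmentD(3)[OF I(1,2)] I(3) by auto
        show "\<exists>t'\<in>J. t < t'" using initial_segmentD(4)[OF I(1,2)] I(3) by blast
      qed
    qed
    moreover have "solves F D J Y"
      unfolding solves_segment_iff[OF seg] using piece by (metis solves_segment_iff)
    ultimately have "sol J Y" using piece \<open>\<exists>t. t \<in> J\<close> by (auto simp: sol_def)
    then show ?thesis unfolding un \<G>_def by blast
  qed
  ultimately obtain G where "G \<in> \<G>" and max: "\<And>X. X \<in> \<G> \<Longrightarrow> G \<subseteq> X \<Longrightarrow> X = G"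
    using subset_Zorn_nonempty[of \<G>] by metis
  then obtain I y where G: "G = gr I y" and Iy: "sol I y" by (auto simp: \<G>_def)
  have "I = {0..}"
  proof (rule ccontr)
    assume "I \<noteq> {0..}"
    then obtain T where "T > 0" and I: "I = {0..<T}"
      using initial_segment_bounded Iy by (auto simp: sol_def)
    have y: "solves F D {0..<T} y" "y 0 = z0" using Iy I by (auto simp: sol_def)
    obtain T' y' where T': "T' > T" and y': "solves F D {0..<T'} y'" "\<forall>t\<in>{0..<T}. y' t = y t"
      using solution_extension[OF K F loc \<open>T > 0\<close> y(1) stay[OF y]] by blast
    have "sol {0..<T'} y'"
      using T' y y' \<open>T > 0\<close> by (auto simp: sol_def initial_segment_atLeastLessThan)
    then have "gr {0..<T'} y' \<in> \<G>" by (auto simp: \<G>_def)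
    moreover have "G \<subseteq> gr {0..<T'} y'" using T' y' by (force simp: G I gr_def)
    ultimately have "gr {0..<T'} y' = gr {0..<T} y" using max by (simp add: G I)
    then have "fst ` gr {0..<T'} y' = fst ` gr {0..<T} y" by simp
    then have "{0..<T'} = {0..<T}" by (simp add: gr_def image_image)
    moreover have "T \<in> {0..<T'}" using T' \<open>T > 0\<close> by simp
    ultimately show False by simp
  qed
  then show ?thesis using Iy by (auto simp: sol_def)
qed

section \<open>Lyapunov's method relative to a forward invariant set\<close>

lemma solves_has_derivative_along:
  fixes F :: "'a::euclidean_space \<Rightarrow> 'a" and V :: "'a \<Rightarrow> real"
  assumes "initial_segment I" and "solves F D I z" and V: "(V has_derivative V') (at (z t))"
    and "t \<in> {a..c}" and "0 \<le> a" and "c \<in> I"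
  shows "((\<lambda>t. V (z t)) has_real_derivative V' (F (z t))) (at t within {a..c})"
proof -
  have "t \<in> I" using assms initial_segmentD(3)[of I c t] by auto
  then have "(z has_vector_derivative F (z t)) (at t within {0..})"
    using assms by (simp add: solves_segment_iff)
  then have z: "(z has_derivative (\<lambda>h. h *\<^sub>R F (z t))) (at t within {a..c})"
    unfolding has_vector_derivative_def[symmetric]
    by (rule has_vector_derivative_within_subset) (use assms in auto)
  have "((\<lambda>t. V (z t)) has_derivative (\<lambda>h. V' (h *\<^sub>R F (z t)))) (at t within {a..c})"
    by (rule has_derivative_compose[OF z V])
  then show ?thesis
    by (simp add: has_field_derivative_def linear_scale[OF has_derivative_linear[OF V]] mult_commute_abs)
qed

text \<open>The function \<open>c\<close> may decrease along solutions at most exponentially, which makes \<open>{c \<ge> 0}\<close>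
  forward invariant; \<open>V\<close> decreases there.  Solutions cannot reach the
  sphere of radius \<open>R\<close> inside \<open>{c \<ge> 0}\<close> because \<open>V\<close> is too large on it.\<close>

lemma lyapunov_asymptotic_stability_rel:
  fixes F :: "'a::euclidean_space \<Rightarrow> 'a" and V c H :: "'a \<Rightarrow> real"
  assumes "R > 0" and D: "cball zs R \<subseteq> D" and F: "continuous_on (cball zs R) F"
    and loc: "\<And>p. p \<in> cball zs R \<Longrightarrow> \<exists>T>0. \<exists>z. solves F D {0..<T} z \<and> z 0 = p"
    and c: "\<And>z. (c has_derivative c' z) (at z)"
    and c_inv: "\<And>z. z \<in> cball zs R \<Longrightarrow> c' z (F z) \<ge> - \<alpha> * c z"
    and S: "\<And>z. z \<in> cball zs R \<Longrightarrow> z \<in> S \<longleftrightarrow> c z \<ge> 0"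
    and V: "\<And>z. (V has_derivative V' z) (at z)" and V0: "V zs = 0"
    and Vpos: "\<And>z. z \<in> cball zs R \<Longrightarrow> c z \<ge> 0 \<Longrightarrow> z \<noteq> zs \<Longrightarrow> V z > 0"
    and Vdec: "\<And>z. z \<in> cball zs R \<Longrightarrow> c z \<ge> 0 \<Longrightarrow> V' z (F z) \<le> - H z"
    and H: "continuous_on (cball zs R) H" and Hnn: "\<And>z. z \<in> cball zs R \<Longrightarrow> H z \<ge> 0"
    and Hpos: "\<And>z. z \<in> cball zs R \<Longrightarrow> c z \<ge> 0 \<Longrightarrow> z \<noteq> zs \<Longrightarrow> H z > 0"
  shows "loc_asymp_stable_rel F D S zs"
proof -
  define K where "K = {z \<in> cball zs R. c z \<ge> 0}"
  have Vc: "continuous_on A V" for A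
    by (intro continuous_at_imp_continuous_on ballI has_derivative_continuous[OF V])
  have cc: "continuous_on A c" for A
    by (intro continuous_at_imp_continuous_on ballI has_derivative_continuous[OF c])
  have closed_part: "compact {z \<in> cball zs R. c z \<ge> 0 \<and> g z \<ge> v}"
    if "continuous_on UNIV g" for g :: "'a \<Rightarrow> real" and v
  proof -
    have "{z \<in> cball zs R. c z \<ge> 0 \<and> g z \<ge> v} = cball zs R \<inter> ({z. 0 \<le> c z} \<inter> {z. v \<le> g z})" by auto
    moreover have "closed ({z. 0 \<le> c z} \<inter> {z. v \<le> g z})"
      by (intro closed_Int closed_Collect_le continuous_intros cc that)
    ultimately show ?thesis by (simp add: compact_Int_closed)
  qed
  have pos_min: "\<exists>v>0. \<forall>z\<in>A. g z \<ge> v" if "compact A" "continuous_on A g" "\<And>z. z \<in> A \<Longrightarrow> g z > 0"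
    for A :: "'a set" and g :: "'a \<Rightarrow> real"
  proof (cases "A = {}")
    case False
    then show ?thesis using continuous_attains_inf[OF that(1) False that(2)] that(3) by blast
  qed (auto intro: exI[of _ 1])
  have "compact K"
    using closed_part[of "\<lambda>_. 0" 0] by (simp add: K_def)
  have dist_c: "continuous_on UNIV (\<lambda>z. dist z zs)" by (intro continuous_intros)
  obtain \<mu> where "\<mu> > 0" and \<mu>: "\<And>z. z \<in> K \<Longrightarrow> dist z zs \<ge> R \<Longrightarrow> V z \<ge> \<mu>"
    using pos_min[OF closed_part[OF dist_c, of R] Vc] Vpos \<open>R > 0\<close> unfolding K_def by fastforce
  define N1 where "N1 = {z \<in> ball zs R. V z < \<mu>}"
  have "open N1"
  proof -
    have "N1 = ball zs R \<inter> {z. V z < \<mu>}" by (auto simp: N1_def)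
    then show ?thesis
      by (simp add: open_Int open_Collect_less Vc)
  qed
  moreover have "zs \<in> N1" using \<open>R > 0\<close> \<open>\<mu> > 0\<close> by (simp add: N1_def V0)
  ultimately have N1: "zs \<in> interior N1" by (simp add: interior_open)
  have c_stays: "c (z t) \<ge> 0"
    if I: "initial_segment I" and z: "solves F D I z" and "c (z 0) \<ge> 0" and "t \<in> I"
      and inR: "\<And>s. s \<in> {0..t} \<Longrightarrow> z s \<in> cball zs R" for I z t
  proof -
    have "t \<ge> 0" by (rule initial_segmentD(2)[OF I \<open>t \<in> I\<close>])
    define \<phi>' where "\<phi>' s = - (exp (\<alpha> * s) * (c' (z s) (F (z s)) + \<alpha> * c (z s)))" for s
    have "- (exp (\<alpha> * t) * c (z t)) \<le> - (exp (\<alpha> * 0) * c (z 0)) + 0 * (t - 0)"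
    proof (rule derivative_le_imp_bound[OF \<open>t \<ge> 0\<close>, of _ \<phi>'])
      fix s assume s: "s \<in> {0..t}"
      show "((\<lambda>s. - (exp (\<alpha> * s) * c (z s))) has_real_derivative \<phi>' s) (at s within {0..t})"
        unfolding \<phi>'_def
        by (rule derivative_eq_intros refl solves_has_derivative_along[OF I z c s _ \<open>t \<in> I\<close>] | simp add: algebra_simps)+
      show "\<phi>' s \<le> 0"
        using c_inv[OF inR[OF s]] by (simp add: \<phi>'_def)
    qed
    then have "exp (\<alpha> * t) * c (z t) \<ge> 0" using \<open>c (z 0) \<ge> 0\<close> by simp
    then show ?thesis by (simp add: zero_le_mult_iff)
  qed
  have V_dec: "V (z t) \<le> V (z s) - \<delta> * (t - s)"
    if I: "initial_segment I" and z: "solves F D I z" and "0 \<le> s" "s \<le> t" "t \<in> I"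
      and inK: "\<And>x. x \<in> {s..t} \<Longrightarrow> z x \<in> K \<and> H (z x) \<ge> \<delta>" for I z s t \<delta>
  proof -
    have "V (z t) \<le> V (z s) + (- \<delta>) * (t - s)"
    proof (rule derivative_le_imp_bound[OF \<open>s \<le> t\<close>, of _ "\<lambda>x. V' (z x) (F (z x))"])
      fix x assume x: "x \<in> {s..t}"
      show "((\<lambda>x. V (z x)) has_real_derivative V' (z x) (F (z x))) (at x within {s..t})"
        by (rule solves_has_derivative_along[OF I z V x \<open>0 \<le> s\<close> \<open>t \<in> I\<close>])
      show "V' (z x) (F (z x)) \<le> - \<delta>"
        using Vdec[of "z x"] inK[OF x] by (auto simp: K_def)
    qed
    then show ?thesis by simp
  qed
  have stay: "z t \<in> K"
    if I: "initial_segment I" and z: "solves F D I z" and z0: "z 0 \<in> N1" "c (z 0) \<ge> 0" and "t \<in> I"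
    for I z t
  proof -
    have zc: "continuous_on {0..t} z" if "t \<in> I" for t
    proof (rule continuous_on_subset)
      show "continuous_on I z"
        unfolding continuous_on_eq_continuous_within
      proof
        fix s assume "s \<in> I"
        then have "(z has_vector_derivative F (z s)) (at s within I)" using z by (simp add: solves_def)
        then show "continuous (at s within I) z" by (rule has_vector_derivative_continuous)
      qed
      show "{0..t} \<subseteq> I" using initial_segmentD(3)[OF I that] by auto
    qed
    have ball: "z t \<in> ball zs R" if "t \<in> I" for t
    proof (rule ccontr)
      assume nb: "z t \<notin> ball zs R"
      have "t \<ge> 0" by (rule initial_segmentD(2)[OF I that])
      define B where "B = {s \<in> {0..t}. z s \<in> - ball zs R}"
      have "closed B"
      proof -
        have "B = {0..t} \<inter> z -` (- ball zs R)" by (auto simp: B_def)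
        then show ?thesis using continuous_closed_preimage[OF zc[OF that], of "- ball zs R"]
          by (simp add: closed_Compl)
      qed
      have "t \<in> B" using nb \<open>t \<ge> 0\<close> by (simp add: B_def)
      have "bdd_below B" unfolding B_def by (rule bdd_belowI[of _ 0]) simp
      \<comment> \<open>the first exit time from the open ball\<close>
      define t1 where "t1 = Inf B"
      have "t1 \<in> B"
        unfolding t1_def using \<open>closed B\<close> \<open>bdd_below B\<close> \<open>t \<in> B\<close> by (intro closed_contains_Inf) auto
      then have t1: "0 \<le> t1" "t1 \<le> t" "z t1 \<notin> ball zs R" unfolding B_def by simp_all
      have "t1 \<in> I" by (rule initial_segmentD(3)[OF I that t1(1,2)])
      have "t1 > 0" using t1 z0 by (cases "t1 = 0") (auto simp: N1_def)
      have before: "z s \<in> ball zs R" if "s \<in> {0..<t1}" for s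
      proof (rule ccontr)
        assume "z s \<notin> ball zs R"
        then have "s \<in> B" using that t1 by (simp add: B_def)
        then have "t1 \<le> s" unfolding t1_def using \<open>bdd_below B\<close> by (rule cInf_lower)
        then show False using that by simp
      qed
      have sub: "z ` closure {0..<t1} \<subseteq> cball zs R"
        by (rule image_closure_subset)
           (use zc[OF \<open>t1 \<in> I\<close>] \<open>t1 > 0\<close> before in \<open>auto simp: less_imp_le\<close>)
      have inR: "z s \<in> cball zs R" if "s \<in> {0..t1}" for s
      proof -
        have "s \<in> closure {0..<t1}" using that \<open>t1 > 0\<close> by simp
        then show ?thesis using sub by blast
      qed
      have inK: "z s \<in> K" if "s \<in> {0..t1}" for s
      proof -
        have "s \<in> I" using initial_segmentD(3)[OF I \<open>t1 \<in> I\<close>] that by auto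
        from c_stays[OF I z z0(2) this] inR that show ?thesis by (simp add: K_def)
      qed
      have "V (z t1) \<le> V (z 0) - 0 * (t1 - 0)"
        by (rule V_dec[OF I z _ t1(1) \<open>t1 \<in> I\<close>]) (use inK Hnn in \<open>auto simp: K_def\<close>)
      moreover have "V (z t1) \<ge> \<mu>"
        using \<mu>[OF inK, of t1] t1 by (simp add: dist_commute)
      ultimately show False using z0 by (simp add: N1_def)
    qed
    have "z s \<in> cball zs R" if "s \<in> {0..t}" for s
      using ball[of s] initial_segmentD(3)[OF I \<open>t \<in> I\<close>] that by (auto simp: less_imp_le)
    with c_stays[OF I z z0(2) \<open>t \<in> I\<close>] ball[OF \<open>t \<in> I\<close>] show ?thesis
      by (simp add: K_def less_imp_le)
  qed
  have conv: "(z \<longlongrightarrow> zs) at_top" if z: "solves F D {0..} z" and zK: "\<And>t. t \<ge> 0 \<Longrightarrow> z t \<in> K" for z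
  proof (rule tendstoI)
    fix e :: real assume "e > 0"
    obtain v where "v > 0" and v: "\<And>p. p \<in> K \<Longrightarrow> dist p zs \<ge> e \<Longrightarrow> V p \<ge> v"
      using pos_min[OF closed_part[OF dist_c, of e] Vc] Vpos \<open>e > 0\<close> unfolding K_def by fastforce
    have "continuous_on {p \<in> cball zs R. c p \<ge> 0 \<and> V p \<ge> v} H"
      by (rule continuous_on_subset[OF H]) auto
    then obtain \<delta> where "\<delta> > 0" and \<delta>: "\<And>p. p \<in> K \<Longrightarrow> V p \<ge> v \<Longrightarrow> H p \<ge> \<delta>"
      using pos_min[OF closed_part[OF Vc, of v], of H] Hpos V0 \<open>v > 0\<close> unfolding K_def by fastforce
    have "\<exists>t0\<ge>0. V (z t0) < v"
    proof (rule ccontr)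
      assume "\<not> (\<exists>t0\<ge>0. V (z t0) < v)"
      then have big: "V (z t) \<ge> v" if "t \<ge> 0" for t using that by (meson not_le)
      define t where "t = V (z 0) / \<delta>"
      have "t \<ge> 0" using big[of 0] \<open>v > 0\<close> \<open>\<delta> > 0\<close> by (simp add: t_def)
      have "V (z t) \<le> V (z 0) - \<delta> * (t - 0)"
        by (rule V_dec[OF initial_segment_atLeast z _ \<open>t \<ge> 0\<close>]) (use \<open>t \<ge> 0\<close> zK \<delta> big in auto)
      then show False using big[OF \<open>t \<ge> 0\<close>] \<open>v > 0\<close> \<open>\<delta> > 0\<close> by (simp add: t_def)
    qed
    then obtain t0 where "t0 \<ge> 0" "V (z t0) < v" by blast
    have "dist (z t) zs < e" if "t \<ge> t0" for t
    proof -
      have "V (z t) \<le> V (z t0) - 0 * (t - t0)"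
        by (rule V_dec[OF initial_segment_atLeast z \<open>t0 \<ge> 0\<close> that])
           (use \<open>t0 \<ge> 0\<close> that zK Hnn in \<open>auto simp: K_def\<close>)
      then show ?thesis using v[of "z t"] zK[of t] \<open>V (z t0) < v\<close> \<open>t0 \<ge> 0\<close> that by force
    qed
    then show "\<forall>\<^sub>F t in at_top. dist (z t) zs < e"
      by (auto simp: eventually_at_top_linorder)
  qed
  have K_sub: "K \<subseteq> cball zs R" by (auto simp: K_def)
  have "zs \<in> interior (cball zs R)" using \<open>R > 0\<close> by (simp add: interior_cball)
  moreover have "(\<exists>z. solves F D {0..} z \<and> z 0 = p) \<and>
      (\<forall>z. solves F D {0..} z \<and> z 0 = p \<longrightarrow> (\<forall>t\<ge>0. z t \<in> cball zs R \<inter> S) \<and> (z \<longlongrightarrow> zs) at_top)"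
    if p: "p \<in> N1 \<inter> S" for p
  proof -
    have cp: "c p \<ge> 0" using p S[of p] by (simp add: N1_def less_imp_le)
    have "p \<in> K" using p cp by (simp add: N1_def K_def less_imp_le)
    have "\<exists>z. solves F D {0..} z \<and> z 0 = p"
    proof (rule global_solution_exists[OF \<open>compact K\<close> _ _ \<open>p \<in> K\<close>])
      show "K \<subseteq> D" using K_sub D by blast
      show "continuous_on K F" using F K_sub continuous_on_subset by blast
      show "\<exists>T>0. \<exists>z. solves F D {0..<T} z \<and> z 0 = q" if "q \<in> K" for q
        using loc that K_sub by blast
      show "z t \<in> K" if "solves F D {0..<T} z" "z 0 = p" "t \<in> {0..<T}" for T z t
        by (rule stay[of "{0..<T}"]) (use that p cp in \<open>auto intro: initial_segment_atLeastLessThan\<close>)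
    qed
    moreover have "(\<forall>t\<ge>0. z t \<in> cball zs R \<inter> S) \<and> (z \<longlongrightarrow> zs) at_top"
      if z: "solves F D {0..} z" "z 0 = p" for z
    proof -
      have zK: "z t \<in> K" if "t \<ge> 0" for t
        by (rule stay[OF initial_segment_atLeast z(1)]) (use that p cp z in auto)
      then show ?thesis using conv[OF z(1) zK] S by (auto simp: K_def)
    qed
    ultimately show ?thesis by blast
  qed
  ultimately show ?thesis
    unfolding loc_asymp_stable_rel_def using N1 by blast
qed

section \<open>The closed loop near a local optimum\<close>

text \<open>The time \<open>T\<close> is chosen such that \<open>k * exp (- c * T) = k / (2 * k + 2)\<close>, which is below \<open>1/2\<close>.\<close>

lemma steady_state_lyapunov_form:
  fixes f :: "(real^'n) \<times> (real^'m) \<Rightarrow> real^'n"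
  assumes st: "glob_exp_stable_eq f u xe" and fd: "(f has_derivative f') (at (xe, u))"
  shows "\<exists>B. bounded_bilinear B \<and> (\<forall>v w. B v w = B w v) \<and> (\<forall>v. v \<noteq> 0 \<longrightarrow> B v v > (0::real)) \<and>
    (\<forall>v. 2 * B v (f' (v, 0)) \<le> - 1/2 * (norm v)\<^sup>2)"
proof -
  define A where "A v = f' (v, 0)" for v
  define g where "g x = f (x, u)" for x
  have gd: "(g has_derivative A) (at xe)"
    unfolding g_def[abs_def] A_def[abs_def]
    by (rule has_derivative_compose[of "\<lambda>x. (x, u)" "\<lambda>v. (v, 0)" xe UNIV f f'])
       (auto intro!: derivative_eq_intros fd)
  then have A: "linear A" by (rule has_derivative_linear)
  obtain E where E: "\<And>v. E 0 v = v" "\<And>t. linear (E t)" "\<And>t v. E t (A v) = A (E t v)"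
    "\<And>t v. ((\<lambda>t. E t v) has_vector_derivative A (E t v)) (at t)"
    using linear_flow_exists[OF A] by metis
  have "g xe = 0" and ex: "\<And>x0. \<exists>\<xi>. solves g UNIV {0..} \<xi> \<and> \<xi> 0 = x0"
    using st by (simp_all add: glob_exp_stable_eq_def g_def[abs_def])
  obtain k c where "k > 0" "c > 0" and kc: "\<And>\<xi> t. solves g UNIV {0..} \<xi> \<Longrightarrow> t \<ge> 0 \<Longrightarrow>
      norm (\<xi> t - xe) \<le> k * norm (\<xi> 0 - xe) * exp (- c * t)"
    using st unfolding glob_exp_stable_eq_def g_def[abs_def] by blast
  define T where "T = ln (2 * k + 2) / c"
  have "T > 0" using \<open>k > 0\<close> \<open>c > 0\<close> by (simp add: T_def)
  have T2: "(norm (E T v))\<^sup>2 \<le> 1/2 * (norm v)\<^sup>2" for v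
  proof -
    have "exp (- c * T) = 1 / (2 * k + 2)"
      using \<open>k > 0\<close> \<open>c > 0\<close> by (simp add: T_def exp_minus inverse_eq_divide)
    moreover have "k * (1 / (2 * k + 2)) \<le> 1 / 2" using \<open>k > 0\<close> by (simp add: field_simps)
    ultimately have "k * exp (- c * T) \<le> 1 / 2" by (simp only:)
    then have "k * exp (- c * T) * norm v \<le> 1 / 2 * norm v" by (rule mult_right_mono) simp
    moreover have "norm (E T v) \<le> k * norm v * exp (- c * T)"
      by (rule linearization_of_exponentially_stable[OF gd \<open>g xe = 0\<close> ex \<open>k > 0\<close> \<open>c > 0\<close> kc
            E(1) E(4) less_imp_le[OF \<open>T > 0\<close>]])
    ultimately have "norm (E T v) \<le> 1 / 2 * norm v" by (simp add: mult_ac)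
    then have "(norm (E T v))\<^sup>2 \<le> (1 / 2 * norm v)\<^sup>2" by (rule power_mono) simp
    also have "\<dots> = 1/4 * (norm v)\<^sup>2" by (simp add: power_mult_distrib power2_eq_square)
    also have "\<dots> \<le> 1/2 * (norm v)\<^sup>2" by (rule mult_right_mono) simp_all
    finally show ?thesis .
  qed
  show ?thesis
    using quadratic_lyapunov_form[OF A E \<open>T > 0\<close> T2] unfolding A_def .
qed

text \<open>On the graph \<open>x = w u\<close> this is the gradient of \<open>\<Phi> \<circ> w\<close>; off the graph it is what the controller
  evaluates from the measured state instead.\<close>

definition reduced_gradient ::
    "(real^'m \<Rightarrow> real^'n) \<Rightarrow> (real^'n \<Rightarrow> real) \<Rightarrow> (real^'n) \<times> (real^'m) \<Rightarrow> real^'m" where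
  "reduced_gradient w \<Phi> = (\<lambda>(x, u). transpose (jacobian w (at u)) *v gradient \<Phi> x)"

lemma reduced_gradient_inner:
  assumes "w differentiable (at u)"
  shows "reduced_gradient w \<Phi> (x, u) \<bullet> q = gradient \<Phi> x \<bullet> frechet_derivative w (at u) q"
proof -
  have "frechet_derivative w (at u) = (\<lambda>h. jacobian w (at u) *v h)"
    using assms by (intro frechet_derivative_at[symmetric]) (simp add: jacobian_works)
  then show ?thesis by (simp add: reduced_gradient_def dot_lmul_matrix)
qed

text \<open>Where \<open>h > 0\<close> the multiplier of \<open>h\<close> vanishes, and that of the equality constraint is
  \<open>- gradient \<Phi> x\<close>.\<close>

lemma P_critical_iff:
  assumes "h x > 0"
  shows "P_critical w \<Phi> h b (x, u) \<longleftrightarrow> x = w u \<and> b u \<ge> 0 \<and>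
    (\<exists>l\<ge>0. reduced_gradient w \<Phi> (x, u) = l *\<^sub>R gradient b u \<and> l * b u = 0)"
proof
  assume "P_critical w \<Phi> h b (x, u)"
  then obtain lh lb \<mu> where 1: "lh \<ge> 0" "lb \<ge> 0" "gradient \<Phi> x - lh *\<^sub>R gradient h x + \<mu> = 0"
    "- lb *\<^sub>R gradient b u - transpose (jacobian w (at u)) *v \<mu> = 0"
    "lh * h x = 0" "lb * b u = 0" "b u \<ge> 0" "x = w u"
    unfolding P_critical_def split by blast
  have "lh = 0" using 1(5) assms by simp
  then have "\<mu> = - gradient \<Phi> x" using 1(3) by (simp add: add_eq_0_iff)
  then have "reduced_gradient w \<Phi> (x, u) = - (transpose (jacobian w (at u)) *v \<mu>)"
    using linear_neg[OF matrix_vector_mul_linear[of "transpose (jacobian w (at u))"], of "gradient \<Phi> x"]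
    by (simp add: reduced_gradient_def del: transpose_matrix_vector)
  also have "\<dots> = lb *\<^sub>R gradient b u" using 1(4) by (metis add.inverse_inverse diff_0 eq_iff_diff_eq_0 scaleR_minus_left)
  finally show "x = w u \<and> b u \<ge> 0 \<and>
    (\<exists>l\<ge>0. reduced_gradient w \<Phi> (x, u) = l *\<^sub>R gradient b u \<and> l * b u = 0)"
    using 1 by blast
next
  assume "x = w u \<and> b u \<ge> 0 \<and>
    (\<exists>l\<ge>0. reduced_gradient w \<Phi> (x, u) = l *\<^sub>R gradient b u \<and> l * b u = 0)"
  then obtain l where l: "x = w u" "b u \<ge> 0" "l \<ge> 0"
    "reduced_gradient w \<Phi> (x, u) = l *\<^sub>R gradient b u" "l * b u = 0" by blast
  have "transpose (jacobian w (at u)) *v (- gradient \<Phi> x) = - (l *\<^sub>R gradient b u)"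
    using l(4) linear_neg[OF matrix_vector_mul_linear[of "transpose (jacobian w (at u))"], of "gradient \<Phi> x"]
    by (simp add: reduced_gradient_def del: transpose_matrix_vector)
  then show "P_critical w \<Phi> h b (x, u)"
    unfolding P_critical_def split
    using l assms by (intro exI[of _ 0] exI[of _ l] exI[of _ "- gradient \<Phi> x"])
      (simp del: transpose_matrix_vector)
qed

text \<open>The cost is the squared distance to \<open>p\<close>, so that the projection onto the half-space given by
  the first constraint solves the program whenever it happens to satisfy the second one.\<close>

lemma SGF_control_eq_halfspace_proj:
  assumes q: "q = halfspace_proj (gradient b u) (\<alpha> * b u) (- \<epsilon> *\<^sub>R reduced_gradient w \<Phi> (x, u))"
    and c1: "SGF_c1 b \<alpha> (x, u) q \<ge> 0"
    and c2: "SGF_c2 f h \<beta> r \<gamma> (x, u) q \<ge> 0"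
  shows "SGF_control f w \<Phi> h b \<beta> r \<epsilon> \<alpha> \<gamma> (x, u) = q"
proof -
  define p where "p = - \<epsilon> *\<^sub>R reduced_gradient w \<Phi> (x, u)"
  have q': "q = halfspace_proj (gradient b u) (\<alpha> * b u) p" by (simp add: q p_def)
  have cost: "SGF_cost w \<Phi> \<epsilon> (x, u) y = 1/2 * (norm (y - p))\<^sup>2" for y
    by (simp add: SGF_cost_def p_def reduced_gradient_def)
  have feas: "q \<in> SGF_feasible f h b \<beta> r \<alpha> \<gamma> (x, u)"
    using c1 c2 by (simp add: SGF_feasible_def)
  have min: "(norm (q - p))\<^sup>2 + (norm (y - q))\<^sup>2 \<le> (norm (y - p))\<^sup>2"
    if "y \<in> SGF_feasible f h b \<beta> r \<alpha> \<gamma> (x, u)" for y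
    unfolding q' by (rule halfspace_proj_minimal) (use that in \<open>simp add: SGF_feasible_def SGF_c1_def\<close>)
  show ?thesis
    unfolding SGF_control_def
  proof (rule arg_minI[where P = "\<lambda>y. y \<in> SGF_feasible f h b \<beta> r \<alpha> \<gamma> (x, u)" and x = q
        and Q = "\<lambda>y. y = q", OF feas])
    show "\<not> SGF_cost w \<Phi> \<epsilon> (x, u) y < SGF_cost w \<Phi> \<epsilon> (x, u) q"
      if "y \<in> SGF_feasible f h b \<beta> r \<alpha> \<gamma> (x, u)" for y
      using min[OF that] zero_le_power2[of "norm (y - q)"] unfolding cost by linarith
    show "y = q"
      if y: "y \<in> SGF_feasible f h b \<beta> r \<alpha> \<gamma> (x, u)"
        and "\<forall>y'. y' \<in> SGF_feasible f h b \<beta> r \<alpha> \<gamma> (x, u) \<longrightarrow>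
          \<not> SGF_cost w \<Phi> \<epsilon> (x, u) y' < SGF_cost w \<Phi> \<epsilon> (x, u) y" for y
    proof -
      have "(norm (y - p))\<^sup>2 \<le> (norm (q - p))\<^sup>2" using that(2)[rule_format, OF feas] unfolding cost by linarith
      then have "(norm (y - q))\<^sup>2 \<le> 0" using min[OF y] by linarith
      then show ?thesis by simp
    qed
  qed
qed

text \<open>The weights of the two squares come from \<open>M e n \<le> e\<^sup>2 / 8 + 2 M\<^sup>2 n\<^sup>2\<close>.\<close>

lemma dissipation_estimate:
  fixes e n M \<epsilon> :: real
  assumes "0 < \<epsilon>" and "\<epsilon> < 1 / (2 * M\<^sup>2 + 1)"
  shows "- n\<^sup>2 / \<epsilon> - 1/4 * e\<^sup>2 + M * e * n \<le> - (n\<^sup>2 + 1/8 * e\<^sup>2)"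
proof -
  have pos: "2 * M\<^sup>2 + 1 > 0" using zero_le_power2[of M] by linarith
  have "\<epsilon> * (2 * M\<^sup>2 + 1) \<le> 1" using assms pos by (simp add: field_simps)
  then have "2 * M\<^sup>2 + 1 \<le> 1 / \<epsilon>" using assms by (simp add: field_simps)
  then have "(2 * M\<^sup>2 + 1) * n\<^sup>2 \<le> 1 / \<epsilon> * n\<^sup>2" by (rule mult_right_mono) simp
  moreover have "0 \<le> 2 * (e / 4 - M * n)\<^sup>2" by simp
  then have "M * e * n \<le> 1/8 * e\<^sup>2 + 2 * M\<^sup>2 * n\<^sup>2"
    by (simp add: power2_eq_square algebra_simps)
  ultimately show ?thesis by (simp add: algebra_simps)
qed

lemma isCont_reduced_gradient:
  fixes w :: "real^'m \<Rightarrow> real^'n"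
  assumes w: "cont_diff (Suc j) w" and \<Phi>: "cont_diff (Suc k) \<Phi>"
  shows "isCont (reduced_gradient w \<Phi>) z"
proof -
  have "reduced_gradient w \<Phi> =
      (\<lambda>z. \<Sum>e\<in>Basis. frechet_derivative \<Phi> (at (fst z)) (frechet_derivative w (at (snd z)) e) *\<^sub>R e)"
    (is "_ = ?R")
  proof
    fix z :: "(real^'n) \<times> (real^'m)"
    obtain x u where z: "z = (x, u)" by force
    have "reduced_gradient w \<Phi> (x, u) \<bullet> e = frechet_derivative \<Phi> (at x) (frechet_derivative w (at u) e)" for e
      using w \<Phi> by (simp add: reduced_gradient_inner gradient_inner)
    then show "reduced_gradient w \<Phi> z = ?R z"
      by (subst euclidean_representation[symmetric]) (simp add: z)
  qed
  moreover have "isCont ?R z"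
    by (intro continuous_sum continuous_scaleR continuous_const
        isCont_frechet_derivative[OF \<Phi>] isCont_frechet_derivative[OF w] isCont_fst isCont_snd continuous_ident)
  ultimately show ?thesis by simp
qed

lemma reduced_gradient_derivative:
  assumes w: "w differentiable (at u)" and \<Phi>: "\<Phi> differentiable (at (w u))"
  shows "((\<lambda>u. \<Phi> (w u)) has_derivative (\<lambda>v. reduced_gradient w \<Phi> (w u, u) \<bullet> v)) (at u)"
  using has_derivative_compose[OF w[unfolded frechet_derivative_works] \<Phi>[unfolded frechet_derivative_works]]
  by (simp add: reduced_gradient_inner[OF w] gradient_inner[OF \<Phi>])

lemma h_seq_equilibrium: "f (x, u) = 0 \<Longrightarrow> h_seq f h \<beta> i (x, u) = \<beta> ^ i * h x"
  by (induction i) auto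

text \<open>At the equilibrium the left-hand side of the second constraint is \<open>\<gamma> h\<^sub>r\<close>, which is positive
  there for every positive gain.  By continuity that constraint is inactive nearby, whatever the
  value of \<open>\<gamma>\<close>; only the size of the neighborhood depends on it.\<close>

lemma SGF_c2_inactive:
  fixes f :: "(real^'n) \<times> (real^'m) \<Rightarrow> real^'n"
  assumes f: "isCont f zs" and hr: "cont_diff (Suc k) (h_seq f h \<beta> r)"
    and q: "isCont q zs" and "f zs = 0" and "q zs = 0"
    and "\<gamma> > 0" and "h_seq f h \<beta> r zs > 0"
  shows "\<forall>\<^sub>F z in nhds zs. SGF_c2 f h \<beta> r \<gamma> z (q z) > 0"
proof -
  let ?g = "h_seq f h \<beta> r"
  have eq: "SGF_c2 f h \<beta> r \<gamma> z (q z) = frechet_derivative ?g (at z) (f z, 0) +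
      frechet_derivative ?g (at z) (0, q z) + \<gamma> * ?g z" for z
    by (cases z) (simp add: SGF_c2_def grad_x_inner[OF cont_diff_SucD(1)[OF hr]]
        grad_u_inner[OF cont_diff_SucD(1)[OF hr]])
  have "isCont ?g zs"
    using has_derivative_continuous[OF cont_diff_SucD(1)[OF hr]] .
  then have "isCont (\<lambda>z. SGF_c2 f h \<beta> r \<gamma> z (q z)) zs"
    unfolding eq
    by (intro isCont_add isCont_mult isCont_frechet_derivative[OF hr] isCont_Pair continuous_ident
        continuous_const f q)
  moreover have "SGF_c2 f h \<beta> r \<gamma> zs (q zs) > 0"
    using assms by (simp add: SGF_c2_def)
  ultimately show ?thesis
    using order_tendstoD(1)[OF tendsto_at_iff_tendsto_nhds[THEN iffD1]] by (simp add: isCont_def)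
qed

lemma tendsto_steady_state:
  assumes "isCont w us" and "xs = w us"
  shows "((\<lambda>z. (w (snd z), snd z)) \<longlongrightarrow> (xs, us)) (nhds (xs, us))"
    and "((\<lambda>u. (w u, u)) \<longlongrightarrow> (xs, us)) (nhds us)"
proof -
  have w: "(w \<longlongrightarrow> xs) (nhds us)"
    using assms by (simp add: isCont_def tendsto_at_iff_tendsto_nhds)
  then show "((\<lambda>u. (w u, u)) \<longlongrightarrow> (xs, us)) (nhds us)"
    by (intro tendsto_Pair filterlim_ident)
  have s: "(snd \<longlongrightarrow> us) (nhds (xs, us))"
    using tendsto_snd[OF filterlim_ident[of "nhds (xs, us)"]] by simp
  show "((\<lambda>z. (w (snd z), snd z)) \<longlongrightarrow> (xs, us)) (nhds (xs, us))"
    by (intro tendsto_Pair s filterlim_compose[OF w s])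
qed

text \<open>A nearby feasible input with the same cost is itself a local minimizer, hence a critical
  point, and critical points are isolated.\<close>

lemma steady_state_cost_minimal:
  fixes w :: "real^'m \<Rightarrow> real^'n"
  assumes w: "cont_diff (Suc i) w" and \<Phi>: "cont_diff (Suc j) \<Phi>" and b: "cont_diff (Suc k) b"
    and h: "continuous_on UNIV h"
    and opt: "P_local_optimum w \<Phi> h b (xs, us)" and "h xs > 0"
    and N: "(xs, us) \<in> interior N"
    and crit: "\<And>z. z \<in> N \<Longrightarrow> P_critical w \<Phi> h b z \<Longrightarrow> z = (xs, us)"
    and reg: "\<And>x u. h x \<ge> 0 \<Longrightarrow> b u = 0 \<Longrightarrow> gradient b u \<noteq> 0"
  shows "\<forall>\<^sub>F u in nhds us. b u \<ge> 0 \<longrightarrow> \<Phi> (w us) \<le> \<Phi> (w u)"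
    and "\<forall>\<^sub>F u in nhds us. b u \<ge> 0 \<longrightarrow> \<Phi> (w u) = \<Phi> (w us) \<longrightarrow> u = us"
proof -
  have xs: "xs = w us" using opt by (simp add: P_local_optimum_def P_feasible_def)
  have wd: "w differentiable (at u)" and \<Phi>d: "\<Phi> differentiable (at x)" and bd: "b differentiable (at u)"
    for u x using w \<Phi> b by simp_all
  have wc: "isCont w us" using wd differentiable_imp_continuous_within by blast
  note lim = tendsto_steady_state(2)[OF wc xs]
  have in_open: "\<forall>\<^sub>F u in nhds us. (w u, u) \<in> interior A" if "(xs, us) \<in> interior A" for A
    using eventually_compose_filterlim[OF eventually_nhds_in_open[OF open_interior that] lim] .
  have "isCont h xs" using h by (simp add: continuous_on_eq_continuous_at)
  then have "((\<lambda>u. h (fst (w u, u))) \<longlongrightarrow> h xs) (nhds us)"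
    using isCont_tendsto_compose[OF _ tendsto_fst[OF lim], of h] by simp
  then have hpos: "\<forall>\<^sub>F u in nhds us. h (w u) > 0"
    using order_tendstoD(1)[OF _ \<open>h xs > 0\<close>] by fastforce
  obtain N' where N': "(xs, us) \<in> interior N'"
    and min: "\<And>z. z \<in> N' \<Longrightarrow> z \<in> P_feasible w h b \<Longrightarrow> \<Phi> xs \<le> \<Phi> (fst z)"
    using opt by (auto simp: P_local_optimum_def)
  show opt': "\<forall>\<^sub>F u in nhds us. b u \<ge> 0 \<longrightarrow> \<Phi> (w us) \<le> \<Phi> (w u)"
    using in_open[OF N'] hpos
  proof eventually_elim
    case (elim u)
    then have "(w u, u) \<in> N'" using interior_subset by blast
    from min[OF this] elim show ?case by (auto simp: P_feasible_def xs)
  qed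
  from opt' have "\<forall>\<^sub>F u in nhds us. \<forall>\<^sub>F y in nhds u. b y \<ge> 0 \<longrightarrow> \<Phi> (w us) \<le> \<Phi> (w y)"
    by (simp add: eventually_eventually)
  with in_open[OF N] hpos
  show "\<forall>\<^sub>F u in nhds us. b u \<ge> 0 \<longrightarrow> \<Phi> (w u) = \<Phi> (w us) \<longrightarrow> u = us"
  proof eventually_elim
    case (elim u)
    show ?case
    proof (intro impI)
      assume bu: "b u \<ge> 0" and eq: "\<Phi> (w u) = \<Phi> (w us)"
      have "(b has_derivative (\<lambda>v. gradient b u \<bullet> v)) (at u)"
        unfolding gradient_inner[OF bd] using bd frechet_derivative_works by blast
      from local_min_KKT[OF reduced_gradient_derivative[OF wd \<Phi>d] this bu]
      have "\<exists>l\<ge>0. reduced_gradient w \<Phi> (w u, u) = l *\<^sub>R gradient b u \<and> l * b u = 0"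
        using elim reg[of "w u" u] by (simp add: eq less_imp_le)
      then have "P_critical w \<Phi> h b (w u, u)"
        using P_critical_iff[of h "w u" w \<Phi> b u] elim(2) bu by blast
      then show "u = us" using crit[of "(w u, u)"] elim interior_subset by blast
    qed
  qed
qed

text \<open>The form \<open>B\<close> belongs to the linearization at one point only; near that point the plant
  differs from it by a relative error that is small enough to keep half of the decay.\<close>

lemma steady_state_dissipation:
  fixes f :: "(real^'n) \<times> (real^'m) \<Rightarrow> real^'n"
  assumes w: "cont_diff (Suc i) w" and \<Phi>: "cont_diff (Suc (Suc j)) \<Phi>" and f: "cont_diff (Suc k) f"
    and st: "steady_state_map f w" and xs: "xs = w us"
  shows "\<exists>B M. bounded_bilinear B \<and> (\<forall>v v'. B v v' = B v' v) \<and> (\<forall>v. v \<noteq> 0 \<longrightarrow> B v v > (0::real)) \<and>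
    (\<forall>\<^sub>F z in nhds (xs, us). \<forall>q.
      reduced_gradient w \<Phi> (w (snd z), snd z) \<bullet> q +
        2 * B (fst z - w (snd z)) (f z - frechet_derivative w (at (snd z)) q)
      \<le> reduced_gradient w \<Phi> z \<bullet> q - 1/4 * (norm (fst z - w (snd z)))\<^sup>2 +
        M * norm (fst z - w (snd z)) * norm q)"
proof -
  define f' where "f' = frechet_derivative f (at (xs, us))"
  have wd: "w differentiable (at u)" for u using w by simp
  have wc: "isCont w us" using wd differentiable_imp_continuous_within by blast
  note lim = tendsto_steady_state(1)[OF wc xs]
  have stu: "glob_exp_stable_eq f u (w u)" for u using st by (simp add: steady_state_map_def)
  then have f0: "f (w u, u) = 0" for u by (simp add: glob_exp_stable_eq_def)
  obtain B where B: "bounded_bilinear B" and sym: "\<forall>v v'. B v v' = B v' v"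
    and pos: "\<forall>v. v \<noteq> 0 \<longrightarrow> B v v > (0::real)"
    and dec: "\<And>v. 2 * B v (f' (v, 0)) \<le> - 1/2 * (norm v)\<^sup>2"
    using steady_state_lyapunov_form[OF stu[of us], of f'] cont_diff_SucD(1)[OF f]
    by (auto simp: f'_def xs)
  obtain K where "K > 0" and K: "\<And>v v'. norm (B v v') \<le> norm v * norm v' * K"
    using bounded_bilinear.pos_bounded[OF B] by blast
  define \<eta> where "\<eta> = 1 / (8 * K)"
  have "\<eta> > 0" using \<open>K > 0\<close> by (simp add: \<eta>_def)
  obtain \<rho>1 where "\<rho>1 > 0" and \<rho>1: "\<And>z y. z \<in> ball (xs, us) \<rho>1 \<Longrightarrow> y \<in> ball (xs, us) \<rho>1 \<Longrightarrow>
      norm (f z - f y - f' (z - y)) \<le> \<eta> * norm (z - y)"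
    using C1_strict_derivative[OF f \<open>\<eta> > 0\<close>] unfolding f'_def by blast
  obtain L \<rho>2 where "L > 0" "\<rho>2 > 0" and \<rho>2: "\<And>x y. x \<in> ball xs \<rho>2 \<Longrightarrow> y \<in> ball xs \<rho>2 \<Longrightarrow>
      norm (gradient \<Phi> x - gradient \<Phi> y) \<le> L * norm (x - y)"
    using C1_lipschitz_near[OF cont_diff_gradient[OF \<Phi>]] by blast
  obtain Mw \<rho>3 where "Mw > 0" "\<rho>3 > 0" and \<rho>3: "\<And>u v. u \<in> ball us \<rho>3 \<Longrightarrow>
      norm (frechet_derivative w (at u) v) \<le> Mw * norm v"
    using C1_derivative_bounded[OF w] by blast
  define M where "M = (L + 2 * K) * Mw"
  have id: "((\<lambda>z. z) \<longlongrightarrow> (xs, us)) (nhds (xs, us))" by (rule filterlim_ident)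
  have inball: "\<forall>\<^sub>F z in nhds (xs, us). g z \<in> ball p \<rho>"
    if "(g \<longlongrightarrow> p) (nhds (xs, us))" "\<rho> > 0" for g :: "_ \<Rightarrow> 'z::metric_space" and p \<rho>
    using tendstoD[OF that] by (simp add: dist_commute)
  have "\<forall>\<^sub>F z in nhds (xs, us). \<forall>q.
      reduced_gradient w \<Phi> (w (snd z), snd z) \<bullet> q +
        2 * B (fst z - w (snd z)) (f z - frechet_derivative w (at (snd z)) q)
      \<le> reduced_gradient w \<Phi> z \<bullet> q - 1/4 * (norm (fst z - w (snd z)))\<^sup>2 +
        M * norm (fst z - w (snd z)) * norm q"
    using inball[OF id \<open>\<rho>1 > 0\<close>] inball[OF lim \<open>\<rho>1 > 0\<close>]
      inball[OF tendsto_fst[OF id] \<open>\<rho>2 > 0\<close>] inball[OF tendsto_fst[OF lim] \<open>\<rho>2 > 0\<close>]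
      inball[OF tendsto_snd[OF id] \<open>\<rho>3 > 0\<close>]
  proof eventually_elim
    case (elim z)
    obtain x u where z: "z = (x, u)" by force
    define e where "e = x - w u"
    have 1: "norm (f (x, u) - f' (e, 0)) \<le> \<eta> * norm e"
      using \<rho>1[OF elim(1,2)] by (simp add: z f0 e_def norm_Pair)
    have 2: "norm (gradient \<Phi> (w u) - gradient \<Phi> x) \<le> L * norm e"
      using \<rho>2[of "w u" x] elim(3,4) by (simp add: z e_def norm_minus_commute)
    have 3: "norm (frechet_derivative w (at u) v) \<le> Mw * norm v" for v
      using \<rho>3[of u] elim(5) by (simp add: z)
    have "reduced_gradient w \<Phi> (w u, u) \<bullet> q + 2 * B e (f (x, u) - frechet_derivative w (at u) q)
      \<le> reduced_gradient w \<Phi> (x, u) \<bullet> q - 1/4 * (norm e)\<^sup>2 + M * norm e * norm q" for q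
    proof -
      let ?d = "frechet_derivative w (at u) q"
      have "(gradient \<Phi> (w u) - gradient \<Phi> x) \<bullet> ?d \<le> norm (gradient \<Phi> (w u) - gradient \<Phi> x) * norm ?d"
        by (rule norm_cauchy_schwarz)
      also have "\<dots> \<le> (L * norm e) * (Mw * norm q)"
        by (intro mult_mono 2 3) (use \<open>L > 0\<close> in auto)
      finally have a: "reduced_gradient w \<Phi> (w u, u) \<bullet> q \<le>
          reduced_gradient w \<Phi> (x, u) \<bullet> q + L * Mw * norm e * norm q"
        by (simp add: reduced_gradient_inner[OF wd] inner_diff_left mult_ac)
      have "norm (B e (f (x, u) - f' (e, 0))) \<le> norm e * (\<eta> * norm e) * K"
        by (rule order_trans[OF K]) (use 1 \<open>K > 0\<close> \<open>\<eta> > 0\<close> in \<open>auto intro!: mult_mono\<close>)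
      also have "\<dots> = 1/8 * (norm e)\<^sup>2"
        using \<open>K > 0\<close> by (simp add: \<eta>_def power2_eq_square)
      finally have b1: "B e (f (x, u) - f' (e, 0)) \<le> 1/8 * (norm e)\<^sup>2" by simp
      have "norm (B e ?d) \<le> norm e * (Mw * norm q) * K"
        by (rule order_trans[OF K]) (use 3 \<open>K > 0\<close> \<open>Mw > 0\<close> in \<open>auto intro!: mult_mono\<close>)
      then have b2: "- B e ?d \<le> K * Mw * norm e * norm q" by (simp add: mult_ac)
      have "B e (f (x, u) - ?d) = B e (f' (e, 0)) + B e (f (x, u) - f' (e, 0)) - B e ?d"
        by (simp add: bounded_bilinear.diff_right[OF B])
      then have "2 * B e (f (x, u) - ?d) \<le> - 1/4 * (norm e)\<^sup>2 + 2 * (K * Mw * norm e * norm q)"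
        using dec[of e] b1 b2 by simp
      with a show ?thesis by (simp add: M_def algebra_simps)
    qed
    then show ?case by (simp add: z e_def)
  qed
  with B sym pos show ?thesis by blast
qed

theorem theoremV5:
  fixes f :: "(real^'n) \<times> (real^'m) \<Rightarrow> real^'n"
    and w :: "real^'m \<Rightarrow> real^'n"
    and \<Phi> h :: "real^'n \<Rightarrow> real"
    and b :: "real^'m \<Rightarrow> real"
    and \<beta> \<alpha> :: real
    and r :: nat
    and xs :: "real^'n" and us :: "real^'m"
    and N :: "((real^'n) \<times> (real^'m)) set"
  assumes "\<beta> > 0" and "\<alpha> > 0"
    and "steady_state_map f w"
    and "regular_data f w \<Phi> h b \<beta> r"
    and "P_local_optimum w \<Phi> h b (xs, us)"
    and "h xs > 0"
    and "(xs, us) \<in> interior N"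
    and "{z \<in> N. P_critical w \<Phi> h b z} = {(xs, us)}"
    and "\<And>c. compact {u. \<Phi> (w u) = c}"
    and "\<And>z. z \<in> N \<Longrightarrow> P_MFCQ w h b z \<or> P_CRCQ w h b z"
  shows "\<exists>\<epsilon>s>0. \<exists>\<gamma>s>0. \<forall>\<epsilon> \<gamma>. 0 < \<epsilon> \<and> \<epsilon> < \<epsilon>s \<and> \<gamma> \<ge> \<gamma>s \<longrightarrow>
           (\<forall>z\<in>N. SGF_feasible f h b \<beta> r \<alpha> \<gamma> z \<noteq> {}) \<longrightarrow>
           (\<forall>z\<in>N. SGF_MFCQ f w \<Phi> h b \<beta> r \<epsilon> \<alpha> \<gamma> z \<or> SGF_CRCQ f w \<Phi> h b \<beta> r \<epsilon> \<alpha> \<gamma> z) \<longrightarrow>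
           (\<forall>z\<in>N. locally_uniquely_solvable (SGF_closed_loop f w \<Phi> h b \<beta> r \<epsilon> \<alpha> \<gamma>)
                      (SGF_domain f h b \<beta> r \<alpha> \<gamma>) z) \<longrightarrow>
           loc_asymp_stable_rel (SGF_closed_loop f w \<Phi> h b \<beta> r \<epsilon> \<alpha> \<gamma>)
             (SGF_domain f h b \<beta> r \<alpha> \<gamma>) (safe_set f h b \<beta> r) (xs, us)"
proof -
  define zs where "zs = (xs, us)"
  have data: "r \<ge> 1" "cont_diff (r + 1) f" "cont_diff (r + 2) h" "cont_diff 2 b" "cont_diff 2 \<Phi>" "cont_diff 2 w"
    and reg: "\<And>x u. h x \<ge> 0 \<Longrightarrow> b u = 0 \<Longrightarrow> gradient b u \<noteq> 0"
    using assms(4) by (auto simp: regular_data_def)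
  have b: "cont_diff (Suc (Suc 0)) b" and \<Phi>: "cont_diff (Suc (Suc 0)) \<Phi>" and w: "cont_diff (Suc (Suc 0)) w"
    using data(4-6) unfolding numeral_2_eq_2 by simp_all
  have f: "cont_diff (Suc 0) f" and h: "cont_diff 1 h"
    using cont_diff_mono[OF _ data(2), of "Suc 0"] cont_diff_mono[OF _ data(3), of 1] data(1) by simp_all
  have hr: "cont_diff (Suc 0) (h_seq f h \<beta> r)"
    by (rule cont_diff_h_seq) (use data(2,3) cont_diff_mono[of "Suc r" "r + 2" h] in simp_all)
  have xs: "xs = w us" and bus: "b us \<ge> 0"
    using assms(5) by (auto simp: P_local_optimum_def P_feasible_def)
  have bd: "b differentiable (at u)" and wd: "w differentiable (at u)" and \<Phi>d: "\<Phi> differentiable (at x)" for u x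
    using b w \<Phi> by simp_all
  have contD: "isCont g a" if "cont_diff (Suc k) g" for g k a
    using has_derivative_continuous[OF cont_diff_SucD(1)[OF that]] .
  have f0: "f zs = 0"
    using assms(3) by (simp add: steady_state_map_def glob_exp_stable_eq_def zs_def xs)
  have hc: "continuous_on UNIV h" by (rule cont_diff_continuous[OF h])
  have crit: "z = zs" if "z \<in> N" "P_critical w \<Phi> h b z" for z
    using assms(8) that by (auto simp: zs_def)
  have "P_critical w \<Phi> h b zs" using assms(8) by (auto simp: zs_def)
  then obtain l where l: "reduced_gradient w \<Phi> zs = l *\<^sub>R gradient b us" "l * b us = 0" "l \<ge> 0"
    using P_critical_iff[of h xs w \<Phi> b us] assms(6) by (auto simp: zs_def)
  have snd_lim: "(snd \<longlongrightarrow> us) (nhds zs)"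
    using tendsto_snd[OF filterlim_ident[of "nhds zs"]] by (simp add: zs_def)
  have nhds_of: "\<forall>\<^sub>F z in nhds zs. P (snd z)" if "\<forall>\<^sub>F u in nhds us. P u" for P
    using eventually_compose_filterlim[OF that snd_lim] .
  have open_of: "\<forall>\<^sub>F z in nhds zs. g z > (0::real)" if "isCont g zs" "g zs > 0" for g
    using order_tendstoD(1)[OF tendsto_at_iff_tendsto_nhds[THEN iffD1]] that by (simp add: isCont_def)
  have isCont_snd': "isCont (\<lambda>z. g (snd z)) z" if "\<And>u. isCont g u" for g :: "real^'m \<Rightarrow> 'z::t2_space"
    and z :: "(real^'n) \<times> (real^'m)"
    by (rule isCont_o2[OF isCont_snd[OF continuous_ident] that])
  have gbc: "isCont (gradient b) u" for u by (rule contD[OF cont_diff_gradient[OF b]])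
  obtain B M where B: "bounded_bilinear B" and sym: "\<And>v v'. B v v' = B v' v"
    and pos: "\<And>v. v \<noteq> 0 \<Longrightarrow> B v v > (0::real)"
    and diss: "\<forall>\<^sub>F z in nhds zs. \<forall>q.
      reduced_gradient w \<Phi> (w (snd z), snd z) \<bullet> q +
        2 * B (fst z - w (snd z)) (f z - frechet_derivative w (at (snd z)) q)
      \<le> reduced_gradient w \<Phi> z \<bullet> q - 1/4 * (norm (fst z - w (snd z)))\<^sup>2 +
        M * norm (fst z - w (snd z)) * norm q"
    using steady_state_dissipation[OF w \<Phi> f assms(3) xs] unfolding zs_def by blast
  have min: "\<forall>\<^sub>F u in nhds us. b u \<ge> 0 \<longrightarrow> \<Phi> (w us) \<le> \<Phi> (w u)"
    and strict: "\<forall>\<^sub>F u in nhds us. b u \<ge> 0 \<longrightarrow> \<Phi> (w u) = \<Phi> (w us) \<longrightarrow> u = us"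
    using steady_state_cost_minimal[OF w \<Phi> b hc assms(5-7)] crit reg unfolding zs_def by blast+
  define V where "V z = \<Phi> (w (snd z)) - \<Phi> (w us) + B (fst z - w (snd z)) (fst z - w (snd z))" for z
  define V' where "V' z v = reduced_gradient w \<Phi> (w (snd z), snd z) \<bullet> snd v +
      2 * B (fst z - w (snd z)) (fst v - frechet_derivative w (at (snd z)) (snd v))" for z v
  have Vd: "(V has_derivative V' z) (at z)" for z
  proof -
    have wsnd: "((\<lambda>z. w (snd z)) has_derivative (\<lambda>v. frechet_derivative w (at (snd z)) (snd v))) (at z)"
      by (rule has_derivative_compose[OF has_derivative_snd[OF has_derivative_ident] cont_diff_SucD(1)[OF w]])
    have e: "((\<lambda>z. fst z - w (snd z)) has_derivative
        (\<lambda>v. fst v - frechet_derivative w (at (snd z)) (snd v))) (at z)"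
      by (intro has_derivative_diff has_derivative_fst has_derivative_ident wsnd)
    have phi: "((\<lambda>z. \<Phi> (w (snd z))) has_derivative
        (\<lambda>v. reduced_gradient w \<Phi> (w (snd z), snd z) \<bullet> snd v)) (at z)"
      by (rule has_derivative_compose[OF has_derivative_snd[OF has_derivative_ident]
            reduced_gradient_derivative[OF wd \<Phi>d]])
    show ?thesis
      unfolding V_def[abs_def]
      by (rule has_derivative_eq_rhs[OF has_derivative_add[OF
              has_derivative_diff[OF phi has_derivative_const] bounded_bilinear.FDERIV[OF B e e]]])
         (simp add: V'_def[abs_def] sym)
  qed
  have "loc_asymp_stable_rel (SGF_closed_loop f w \<Phi> h b \<beta> r \<epsilon> \<alpha> \<gamma>)
             (SGF_domain f h b \<beta> r \<alpha> \<gamma>) (safe_set f h b \<beta> r) (xs, us)"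
    if \<epsilon>: "0 < \<epsilon>" "\<epsilon> < 1 / (2 * M\<^sup>2 + 1)" and "\<gamma> \<ge> 1"
      and solv: "\<forall>z\<in>N. locally_uniquely_solvable (SGF_closed_loop f w \<Phi> h b \<beta> r \<epsilon> \<alpha> \<gamma>)
                      (SGF_domain f h b \<beta> r \<alpha> \<gamma>) z" for \<epsilon> \<gamma>
  proof -
    define p where "p z = - \<epsilon> *\<^sub>R reduced_gradient w \<Phi> z" for z
    define q where "q z = halfspace_proj (gradient b (snd z)) (\<alpha> * b (snd z)) (p z)" for z
    have pc: "isCont p z" for z
      unfolding p_def[abs_def] by (intro continuous_intros isCont_reduced_gradient[OF w \<Phi>])
    \<comment> \<open>If \<open>b us > 0\<close> the multiplier of \<open>b\<close> vanishes at the optimum, so \<open>p zs = 0\<close> lies strictly inside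
      the half-space; otherwise \<open>b us = 0\<close> and the gradient of \<open>b\<close> does not vanish.\<close>
    have regz: "\<forall>\<^sub>F z in nhds zs. gradient b (snd z) \<noteq> 0 \<or>
        (\<alpha> * b (snd z) + gradient b (snd z) \<bullet> p z > 0 \<and> \<alpha> * b (snd z) \<ge> 0)"
    proof (cases "b us = 0")
      case True
      have "gradient b us \<noteq> 0" using reg[of xs us] True assms(6) by simp
      then have "\<forall>\<^sub>F u in nhds us. gradient b u \<noteq> 0"
        using tendsto_imp_eventually_ne[OF tendsto_at_iff_tendsto_nhds[THEN iffD1]] gbc[of us]
        by (simp add: isCont_def)
      from nhds_of[OF this] show ?thesis by eventually_elim simp
    next
      case False
      then have "b us > 0" "p zs = 0" using bus l by (auto simp: p_def)
      have 1: "\<forall>\<^sub>F z in nhds zs. b (snd z) > 0"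
        by (rule open_of[OF isCont_snd'[OF contD[OF b]]]) (simp add: zs_def \<open>b us > 0\<close>)
      have "\<forall>\<^sub>F z in nhds zs. \<alpha> * b (snd z) + gradient b (snd z) \<bullet> p z > 0"
        by (rule open_of)
           (auto intro!: isCont_add isCont_mult continuous_const isCont_snd'[OF contD[OF b]]
              continuous_inner isCont_snd'[OF gbc] pc simp: zs_def[symmetric] \<open>p zs = 0\<close>
              \<open>\<alpha> > 0\<close> \<open>b us > 0\<close>, simp add: zs_def \<open>\<alpha> > 0\<close> \<open>b us > 0\<close>)
      with 1 show ?thesis
        by eventually_elim (use \<open>\<alpha> > 0\<close> in simp)
    qed
    have qc: "isCont q z"
      if "gradient b (snd z) \<noteq> 0 \<or>
        (\<alpha> * b (snd z) + gradient b (snd z) \<bullet> p z > 0 \<and> \<alpha> * b (snd z) \<ge> 0)" for z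
      unfolding q_def[abs_def]
      by (rule isCont_halfspace_proj)
         (use that in \<open>auto intro!: isCont_mult continuous_const isCont_snd'[OF contD[OF b]] isCont_snd'[OF gbc] pc\<close>)
    have q0: "q zs = 0"
      unfolding q_def
      by (rule halfspace_proj_eq_0_iff[THEN iffD2])
         (use bus \<open>\<alpha> > 0\<close> l \<epsilon> in \<open>auto simp: p_def zs_def intro!: exI[of _ "\<epsilon> * l"]\<close>)
    have qczs: "isCont q zs" by (rule qc[OF eventually_nhds_x_imp_x[OF regz]])
    have hrzs: "h_seq f h \<beta> r zs > 0"
      using assms(1,6) h_seq_equilibrium[of f xs us h \<beta> r] f0 by (simp add: zs_def)
    have c2: "\<forall>\<^sub>F z in nhds zs. SGF_c2 f h \<beta> r \<gamma> z (q z) > 0"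
      by (rule SGF_c2_inactive[where k = 0])
         (use contD[OF f] hr qczs f0 q0 \<open>\<gamma> \<ge> 1\<close> hrzs in auto)
    have hrpos: "\<forall>\<^sub>F z in nhds zs. h_seq f h \<beta> r z > 0"
      by (rule open_of[OF contD[OF hr] hrzs])
    have hx: "isCont h x" for x using hc by (simp add: continuous_on_eq_continuous_at)
    have hpos: "\<forall>\<^sub>F z in nhds zs. h (fst z) > 0"
      by (rule open_of[OF isCont_o2[OF isCont_fst[OF continuous_ident] hx]])
         (simp add: zs_def assms(6))
    have inN: "\<forall>\<^sub>F z in nhds zs. z \<in> interior N"
      using eventually_nhds_in_open[OF open_interior assms(7)] by (simp add: zs_def)
    obtain \<rho> where "\<rho> > 0" and near: "\<And>z. dist z zs < \<rho> \<Longrightarrow>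
        (gradient b (snd z) \<noteq> 0 \<or>
          (\<alpha> * b (snd z) + gradient b (snd z) \<bullet> p z > 0 \<and> \<alpha> * b (snd z) \<ge> 0)) \<and>
        SGF_c2 f h \<beta> r \<gamma> z (q z) > 0 \<and> h_seq f h \<beta> r z > 0 \<and> h (fst z) > 0 \<and> z \<in> interior N \<and>
        (\<forall>q. reduced_gradient w \<Phi> (w (snd z), snd z) \<bullet> q +
            2 * B (fst z - w (snd z)) (f z - frechet_derivative w (at (snd z)) q)
          \<le> reduced_gradient w \<Phi> z \<bullet> q - 1/4 * (norm (fst z - w (snd z)))\<^sup>2 +
            M * norm (fst z - w (snd z)) * norm q) \<and>
        (b (snd z) \<ge> 0 \<longrightarrow> \<Phi> (w us) \<le> \<Phi> (w (snd z))) \<and>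
        (b (snd z) \<ge> 0 \<longrightarrow> \<Phi> (w (snd z)) = \<Phi> (w us) \<longrightarrow> snd z = us)"
      using eventually_conj[OF regz eventually_conj[OF c2 eventually_conj[OF hrpos eventually_conj[OF hpos
            eventually_conj[OF inN eventually_conj[OF diss eventually_conj[OF nhds_of[OF min]
            nhds_of[OF strict]]]]]]]]
      unfolding eventually_nhds_metric by blast
    define R where "R = \<rho> / 2"
    have "R > 0" using \<open>\<rho> > 0\<close> by (simp add: R_def)
    have R: "dist z zs < \<rho>" if "z \<in> cball zs R" for z
      using that \<open>\<rho> > 0\<close> by (simp add: R_def dist_commute)
    let ?F = "SGF_closed_loop f w \<Phi> h b \<beta> r \<epsilon> \<alpha> \<gamma>" and ?D = "SGF_domain f h b \<beta> r \<alpha> \<gamma>"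
    have c1: "gradient b (snd z) \<bullet> q z + \<alpha> * b (snd z) \<ge> 0" if "z \<in> cball zs R" for z
      unfolding q_def by (rule halfspace_proj_feasible) (use near[OF R[OF that]] in blast)
    have Feq: "?F z = (f z, q z)" and inD: "z \<in> ?D" if z: "z \<in> cball zs R" for z
    proof -
      obtain x u where xu: "z = (x, u)" by force
      have 1: "SGF_c1 b \<alpha> (x, u) (q z) \<ge> 0" using c1[OF z] by (simp add: SGF_c1_def xu)
      have 2: "SGF_c2 f h \<beta> r \<gamma> (x, u) (q z) \<ge> 0" using near[OF R[OF z]] by (simp add: xu less_imp_le)
      have "q z = halfspace_proj (gradient b u) (\<alpha> * b u) (- \<epsilon> *\<^sub>R reduced_gradient w \<Phi> (x, u))"
        by (simp add: q_def p_def xu)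
      from SGF_control_eq_halfspace_proj[OF this 1 2] show "?F z = (f z, q z)"
        by (simp add: SGF_closed_loop_def xu)
      show "z \<in> ?D" using 1 2 by (auto simp: SGF_domain_def SGF_feasible_def xu)
    qed
    have qcont: "continuous_on (cball zs R) q"
      by (intro continuous_at_imp_continuous_on ballI qc) (use near R in blast)
    define H where "H z = (norm (q z))\<^sup>2 + 1/8 * (norm (fst z - w (snd z)))\<^sup>2" for z
    have "loc_asymp_stable_rel ?F ?D (safe_set f h b \<beta> r) zs"
    proof (rule lyapunov_asymptotic_stability_rel[where V = V and V' = V' and H = H and R = R
          and c = "\<lambda>z. b (snd z)" and c' = "\<lambda>z v. gradient b (snd z) \<bullet> snd v" and \<alpha> = \<alpha>, OF \<open>R > 0\<close>])
      show "cball zs R \<subseteq> ?D" using inD by blast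
      have "continuous_on (cball zs R) (\<lambda>z. (f z, q z))"
        by (intro continuous_on_Pair qcont continuous_at_imp_continuous_on ballI contD[OF f])
      then show "continuous_on (cball zs R) ?F"
        by (rule continuous_on_eq) (simp only: Feq)
      show "\<exists>T>0. \<exists>z. solves ?F ?D {0..<T} z \<and> z 0 = y" if "y \<in> cball zs R" for y
        using solv near[OF R[OF that]] interior_subset unfolding locally_uniquely_solvable_def by blast
      show "((\<lambda>z. b (snd z)) has_derivative (\<lambda>v. gradient b (snd z) \<bullet> snd v)) (at z)" for z
        unfolding gradient_inner[OF bd]
        by (rule has_derivative_compose[OF has_derivative_snd[OF has_derivative_ident] cont_diff_SucD(1)[OF b]])
      show "gradient b (snd z) \<bullet> snd (?F z) \<ge> - \<alpha> * b (snd z)" if "z \<in> cball zs R" for z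
        using c1[OF that] by (simp add: Feq[OF that])
      show "z \<in> safe_set f h b \<beta> r \<longleftrightarrow> b (snd z) \<ge> 0" if "z \<in> cball zs R" for z
        using near[OF R[OF that]] by (cases z) (auto simp: safe_set_def)
      show "(V has_derivative V' z) (at z)" for z by (rule Vd)
      show "V zs = 0"
        using bounded_bilinear.zero_left[OF B] by (simp add: V_def zs_def xs)
      show "V z > 0" if z: "z \<in> cball zs R" and bz: "b (snd z) \<ge> 0" and "z \<noteq> zs" for z
      proof (cases "fst z = w (snd z)")
        case True
        then have "snd z \<noteq> us" using \<open>z \<noteq> zs\<close> by (auto simp: zs_def xs prod_eq_iff)
        then have "\<Phi> (w us) < \<Phi> (w (snd z))" using near[OF R[OF z]] bz by (metis order_le_less)
        then show ?thesis using True bounded_bilinear.zero_left[OF B] by (simp add: V_def)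
      next
        case False
        then have "B (fst z - w (snd z)) (fst z - w (snd z)) > 0" by (intro pos) simp
        then show ?thesis using near[OF R[OF z]] bz by (simp add: V_def add_nonneg_pos)
      qed
      show "V' z (?F z) \<le> - H z" if z: "z \<in> cball zs R" and bz: "b (snd z) \<ge> 0" for z
      proof -
        have "(norm (q z))\<^sup>2 \<le> p z \<bullet> q z"
          unfolding q_def by (rule halfspace_proj_descent) (use bz \<open>\<alpha> > 0\<close> in simp)
        then have "reduced_gradient w \<Phi> z \<bullet> q z \<le> - (norm (q z))\<^sup>2 / \<epsilon>"
          using \<epsilon> by (simp add: p_def field_simps)
        moreover have "V' z (?F z) \<le> reduced_gradient w \<Phi> z \<bullet> q z -
            1/4 * (norm (fst z - w (snd z)))\<^sup>2 + M * norm (fst z - w (snd z)) * norm (q z)"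
          using near[OF R[OF z]] by (simp add: V'_def Feq[OF z])
        ultimately show ?thesis
          using dissipation_estimate[OF \<epsilon>, of "norm (q z)" "norm (fst z - w (snd z))"]
          unfolding H_def by linarith
      qed
      show "continuous_on (cball zs R) H"
        unfolding H_def[abs_def]
        by (intro continuous_intros qcont continuous_at_imp_continuous_on ballI isCont_snd'[OF contD[OF w]])
      show "H z \<ge> 0" for z by (simp add: H_def)
      show "H z > 0" if z: "z \<in> cball zs R" and bz: "b (snd z) \<ge> 0" and "z \<noteq> zs" for z
      proof (rule ccontr)
        assume "\<not> H z > 0"
        then have "(norm (q z))\<^sup>2 + 1/8 * (norm (fst z - w (snd z)))\<^sup>2 \<le> 0" by (simp add: H_def)
        moreover have "(norm (q z))\<^sup>2 \<ge> 0" "(norm (fst z - w (snd z)))\<^sup>2 \<ge> 0" by simp_all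
        ultimately have "(norm (q z))\<^sup>2 = 0" "(norm (fst z - w (snd z)))\<^sup>2 = 0" by linarith+
        then have "q z = 0" and e0: "fst z = w (snd z)" by simp_all
        then obtain m where m: "m \<ge> 0" "p z = - m *\<^sub>R gradient b (snd z)" "m * (\<alpha> * b (snd z)) = 0"
          using halfspace_proj_eq_0_iff[of "\<alpha> * b (snd z)" "gradient b (snd z)" "p z"] bz \<open>\<alpha> > 0\<close>
          by (auto simp: q_def)
        have "\<epsilon> *\<^sub>R reduced_gradient w \<Phi> z = m *\<^sub>R gradient b (snd z)"
          using m(2) by (simp add: p_def)
        then have "inverse \<epsilon> *\<^sub>R (\<epsilon> *\<^sub>R reduced_gradient w \<Phi> z) = inverse \<epsilon> *\<^sub>R (m *\<^sub>R gradient b (snd z))"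
          by simp
        then have "reduced_gradient w \<Phi> z = (m / \<epsilon>) *\<^sub>R gradient b (snd z)"
          using \<epsilon> by (simp add: divide_inverse mult.commute)
        moreover have "m / \<epsilon> \<ge> 0" "m / \<epsilon> * b (snd z) = 0" using m \<epsilon> \<open>\<alpha> > 0\<close> by auto
        ultimately have ex: "\<exists>l\<ge>0. reduced_gradient w \<Phi> (fst z, snd z) = l *\<^sub>R gradient b (snd z) \<and> l * b (snd z) = 0"
          unfolding prod.collapse by blast
        have hz: "h (fst z) > 0" and "z \<in> N"
          using near[OF R[OF z]] interior_subset[of N] by blast+
        have "P_critical w \<Phi> h b (fst z, snd z)"
          unfolding P_critical_iff[of h, OF hz] using e0 bz ex by blast
        then have "z = zs" using crit[OF \<open>z \<in> N\<close>] by simp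
        then show False using \<open>z \<noteq> zs\<close> by simp
      qed
    qed
    then show ?thesis by (simp add: zs_def)
  qed
  moreover have "1 / (2 * M\<^sup>2 + 1) > 0"
    using zero_le_power2[of M] by (simp add: add_nonneg_pos)
  moreover have "(1::real) > 0" by simp
  ultimately show ?thesis by blast
qed

end
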